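(* Let $h,\tilde h$ be bounded functions on $\Omega\cup\Gamma_N$ with $h$ upper semicontinuous and $\tilde h$ lower semicontinuous, such that $h\le\tilde h$ and at least one of the following holds: $h<\tilde h$ everywhere; $h\equiv0$; $\tilde h>0$ everywhere. Suppose $u\in USC(\bar\Omega)$ is a viscosity subsolution of $$-\Delta_\infty u-\beta|Du|\le h\text{ in }\Omega,\qquad D_\nu u\le0\text{ on }\Gamma_N,$$ and $v\in LSC(\bar\Omega)$ is a viscosity supersolution of $$-\Delta_\infty v-\beta|Dv|\ge \tilde h\text{ in }\Omega,\qquad D_\nu v\ge0\text{ on }\Gamma_N.$$ Then $\max_{\bar\Omega}(u-v)=\max_{\Gamma_D}(u-v)$.
   Context: Standing setting: $\Omega\subseteq\mathbb{R}^n$ is a bounded, open, connected set with $C^1$ boundary; $\nu$ is the outward unit normal. For some open $A\subseteq\mathbb{R}^n$, $\Gamma_N:=\partial\Omega\cap A$, $\Gamma_D:=\partial\Omega\setminus A\neq\emptyset$. If $\Gamma_N\ne\emptyset$, $\Omega$ is convex. $\beta\in\mathbb{R}$. For $\varphi\in C^2$: $\Delta_\infty^+\varphi(x):=|D\varphi|^{-2}\langle D^2\varphi D\varphi,D\varphi\rangle(x)$ if $D\varphi(x)\ne0$, else $\max_{|v|=1}\langle D^2\varphi(x)v,v\rangle$; $\Delta^-_\infty\varphi:=-\Delta^+_\infty(-\varphi)$. Subsolution (for $h$ USC on $\Omega\cup\Gamma_N$): $u$ USC such that for every $\varphi\in C^2(\bar\Omega)$ and $x_0\in\Omega\cup\Gamma_N$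 where $u-\varphi$ has a local maximum relative to $\bar\Omega$: $-\Delta^+_\infty\varphi(x_0)-\beta|D\varphi(x_0)|\le h(x_0)$, or $x_0\in\Gamma_N$ and $D\varphi(x_0)\cdot\nu(x_0)\le0$. Supersolution (for $\tilde h$ LSC on $\Omega\cup\Gamma_N$): $v$ LSC such that for every $\varphi\in C^2(\bar\Omega)$ and $x_0\in\Omega\cup\Gamma_N$ where $v-\varphi$ has a local minimum relative to $\bar\Omega$: $-\Delta^-_\infty\varphi(x_0)-\beta|D\varphi(x_0)|\ge \tilde h(x_0)$, or $x_0\in\Gamma_N$ and $D\varphi(x_0)\cdot\nu(x_0)\ge0$. *)

theory Defs
  imports "HOL-Analysis.Analysis"
begin

definition usc_on :: "'a::metric_space set \<Rightarrow> ('a \<Rightarrow> real) \<Rightarrow> bool" where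
  "usc_on S f \<longleftrightarrow> (\<forall>x\<in>S. \<forall>e>0. \<exists>d>0. \<forall>y\<in>S. dist y x < d \<longrightarrow> f y < f x + e)"

definition lsc_on :: "'a::metric_space set \<Rightarrow> ('a \<Rightarrow> real) \<Rightarrow> bool" where
  "lsc_on S f \<longleftrightarrow> (\<forall>x\<in>S. \<forall>e>0. \<exists>d>0. \<forall>y\<in>S. dist y x < d \<longrightarrow> f x - e < f y)"

definition C1_boundary_normal :: "'a::euclidean_space set \<Rightarrow> ('a \<Rightarrow> 'a) \<Rightarrow> bool" where
  "C1_boundary_normal \<Omega> \<nu> \<longleftrightarrow>
     (\<forall>x\<in>frontier \<Omega>. \<exists>r>0. \<exists>\<psi> D\<psi>.
        (\<forall>y\<in>ball x r. (\<psi> has_derivative (\<lambda>k. D\<psi> y \<bullet> k)) (at y) \<and> D\<psi> y \<noteq> 0) \<and>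
        continuous_on (ball x r) D\<psi> \<and>
        \<Omega> \<inter> ball x r = {y \<in> ball x r. \<psi> y < 0} \<and>
        \<nu> x = D\<psi> x /\<^sub>R norm (D\<psi> x))"

definition C2_closure ::
  "'a::euclidean_space set \<Rightarrow> ('a \<Rightarrow> real) \<Rightarrow> ('a \<Rightarrow> 'a) \<Rightarrow> ('a \<Rightarrow> ('a \<Rightarrow>\<^sub>L 'a)) \<Rightarrow> bool" where
  "C2_closure \<Omega> \<phi> G H \<longleftrightarrow>
     continuous_on (closure \<Omega>) \<phi> \<and> continuous_on (closure \<Omega>) G \<and> continuous_on (closure \<Omega>) H \<and>
     (\<forall>x\<in>\<Omega>. (\<phi> has_derivative (\<lambda>k. G x \<bullet> k)) (at x) \<and>
              (G has_derivative blinfun_apply (H x)) (at x))"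

definition inf_lap_plus :: "'a::euclidean_space \<Rightarrow> ('a \<Rightarrow>\<^sub>L 'a) \<Rightarrow> real" where
  "inf_lap_plus g A =
     (if g \<noteq> 0 then (blinfun_apply A g \<bullet> g) / (norm g)\<^sup>2
      else Sup ((\<lambda>v. blinfun_apply A v \<bullet> v) ` sphere 0 1))"

definition inf_lap_minus :: "'a::euclidean_space \<Rightarrow> ('a \<Rightarrow>\<^sub>L 'a) \<Rightarrow> real" where
  "inf_lap_minus g A = - inf_lap_plus (- g) (- A)"

definition local_max_rel :: "'a::metric_space set \<Rightarrow> ('a \<Rightarrow> real) \<Rightarrow> 'a \<Rightarrow> bool" where
  "local_max_rel S f x0 \<longleftrightarrow> (\<exists>e>0. \<forall>y\<in>S. dist y x0 < e \<longrightarrow> f y \<le> f x0)"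

definition local_min_rel :: "'a::metric_space set \<Rightarrow> ('a \<Rightarrow> real) \<Rightarrow> 'a \<Rightarrow> bool" where
  "local_min_rel S f x0 \<longleftrightarrow> (\<exists>e>0. \<forall>y\<in>S. dist y x0 < e \<longrightarrow> f x0 \<le> f y)"

definition viscosity_subsolution ::
  "'a::euclidean_space set \<Rightarrow> 'a set \<Rightarrow> ('a \<Rightarrow> 'a) \<Rightarrow> real \<Rightarrow> ('a \<Rightarrow> real) \<Rightarrow> ('a \<Rightarrow> real) \<Rightarrow> bool" where
  "viscosity_subsolution \<Omega> \<Gamma>N \<nu> \<beta> h u \<longleftrightarrow>
     usc_on (closure \<Omega>) u \<and>
     (\<forall>\<phi> G H x0. C2_closure \<Omega> \<phi> G H \<longrightarrow> x0 \<in> \<Omega> \<union> \<Gamma>N \<longrightarrow>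
        local_max_rel (closure \<Omega>) (\<lambda>y. u y - \<phi> y) x0 \<longrightarrow>
        (- inf_lap_plus (G x0) (H x0) - \<beta> * norm (G x0) \<le> h x0 \<or>
         (x0 \<in> \<Gamma>N \<and> G x0 \<bullet> \<nu> x0 \<le> 0)))"

definition viscosity_supersolution ::
  "'a::euclidean_space set \<Rightarrow> 'a set \<Rightarrow> ('a \<Rightarrow> 'a) \<Rightarrow> real \<Rightarrow> ('a \<Rightarrow> real) \<Rightarrow> ('a \<Rightarrow> real) \<Rightarrow> bool" where
  "viscosity_supersolution \<Omega> \<Gamma>N \<nu> \<beta> h v \<longleftrightarrow>
     lsc_on (closure \<Omega>) v \<and>
     (\<forall>\<phi> G H x0. C2_closure \<Omega> \<phi> G H \<longrightarrow> x0 \<in> \<Omega> \<union> \<Gamma>N \<longrightarrow>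
        local_min_rel (closure \<Omega>) (\<lambda>y. v y - \<phi> y) x0 \<longrightarrow>
        (- inf_lap_minus (G x0) (H x0) - \<beta> * norm (G x0) \<ge> h x0 \<or>
         (x0 \<in> \<Gamma>N \<and> G x0 \<bullet> \<nu> x0 \<ge> 0)))"

end

theory Submission
  imports Defs "HOL-Real_Asymp.Real_Asymp"
begin

text \<open>
  Put \<open>w = - v\<close>, which is a subsolution for \<open>- \<beta>\<close> and \<open>- h'\<close>, and let \<open>u\<^sup>\<epsilon>\<close> be the maximum of \<open>u\<close>
  over the ball of radius \<open>\<epsilon>\<close> intersected with the closure of the domain. Comparison
  with radial solutions \<open>g\<close> of \<open>g'' + \<beta> g' = - C\<close> centred at \<open>x\<close> yields, whenever \<open>h < C\<close> near \<open>x\<close>,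
  the three-point inequality
  \<open>(1 + q) (u\<^sup>\<epsilon> - u) \<le> u\<^bsup>2\<epsilon>\<^esup> - u + C \<epsilon> E(\<epsilon>)\<close> at \<open>x\<close>, where \<open>q = exp (- \<beta> \<epsilon>)\<close> and
  \<open>E' + \<beta> E = 1\<close>, \<open>E(0) = 0\<close>. On the Neumann part, convexity makes the gradient of the
  cone point strictly outward as soon as its vertex is moved slightly into the open domain.
  At a maximum point of \<open>u\<^sup>\<epsilon> + w\<^sup>\<epsilon>\<close> the inequalities for \<open>u\<close> and \<open>w\<close> contradict each other if
  \<open>h < h'\<close>, and in the homogeneous case force \<open>u\<close> and \<open>w\<close> to be constant on balls. When \<open>h'\<close> is
  positive, \<open>v\<close> is replaced by \<open>(1 + \<delta>) v\<close> and \<open>\<delta>\<close> tends to \<open>0\<close>.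
\<close>

section \<open>Radial solutions\<close>

text \<open>The solution of E' + \<beta> E = 1 with E(0) = 0; the branch \<beta> = 0 is the limit of
  the other one.\<close>

definition cone1 :: "real \<Rightarrow> real \<Rightarrow> real" where
  "cone1 \<beta> r = (if \<beta> = 0 then r else (1 - exp (- \<beta> * r)) / \<beta>)"

text \<open>The primitive of \<open>cone1\<close> vanishing at 0, so it solves P'' + \<beta> P' = 1
  with P(0) = P'(0) = 0.\<close>

definition cone2 :: "real \<Rightarrow> real \<Rightarrow> real" where
  "cone2 \<beta> r = (if \<beta> = 0 then r\<^sup>2 / 2 else (r - cone1 \<beta> r) / \<beta>)"

lemma cone_0 [simp]: "cone1 \<beta> 0 = 0" "cone2 \<beta> 0 = 0"
  by (auto simp: cone1_def cone2_def)

lemma exp_eq_cone1: "exp (- \<beta> * r) = 1 - \<beta> * cone1 \<beta> r"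
  by (auto simp: cone1_def)

lemma has_derivative_cone1 [derivative_intros]:
  "(cone1 \<beta> has_real_derivative 1 - \<beta> * cone1 \<beta> r) (at r)"
proof (cases "\<beta> = 0")
  case True
  then have "cone1 \<beta> = (\<lambda>r. r)" by (auto simp: cone1_def)
  with True show ?thesis by simp
next
  case False
  then have "cone1 \<beta> = (\<lambda>r. (1 - exp (- \<beta> * r)) / \<beta>)" by (auto simp: cone1_def)
  then show ?thesis
    unfolding exp_eq_cone1[symmetric]
    using False by (auto intro!: derivative_eq_intros)
qed

lemma has_derivative_cone2 [derivative_intros]:
  "(cone2 \<beta> has_real_derivative cone1 \<beta> r) (at r)"
proof (cases "\<beta> = 0")
  case True
  then have "cone2 \<beta> = (\<lambda>r. r\<^sup>2 / 2)" by (auto simp: cone2_def)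
  with True show ?thesis by (auto intro!: derivative_eq_intros simp: cone1_def)
next
  case False
  then have "cone2 \<beta> = (\<lambda>r. (r - cone1 \<beta> r) / \<beta>)" by (auto simp: cone2_def)
  then show ?thesis
    using False by (auto intro!: derivative_eq_intros)
qed

lemma cone1_strict_mono: "r < t \<Longrightarrow> cone1 \<beta> r < cone1 \<beta> t"
  by (rule DERIV_pos_imp_increasing)
    (use has_derivative_cone1 exp_eq_cone1[symmetric] exp_gt_zero in \<open>metis\<close>)+

lemma cone1_pos: "0 < r \<Longrightarrow> 0 < cone1 \<beta> r"
  using cone1_strict_mono[of 0 r] by simp

lemma cone2_pos:
  assumes "0 < r"
  shows "0 < cone2 \<beta> r"
proof -
  have "cone2 \<beta> 0 < cone2 \<beta> r"
    using assms by (intro DERIV_pos_imp_increasing_open[OF assms])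
      (auto intro: has_derivative_cone2 cone1_pos DERIV_isCont continuous_at_imp_continuous_on)
  then show ?thesis by simp
qed

lemma cone1_double: "cone1 \<beta> (2 * e) = (1 + exp (- \<beta> * e)) * cone1 \<beta> e"
proof -
  have "exp (- \<beta> * (2 * e)) = exp (- \<beta> * e) * exp (- \<beta> * e)"
    by (simp flip: exp_add)
  then show ?thesis by (auto simp: cone1_def field_simps)
qed

text \<open>Together with \<open>cone1_double\<close> this gives (1 + q) g(\<epsilon>) = g(2
  \<epsilon>) + C \<epsilon> E(\<epsilon>), with q = exp (- \<beta> \<epsilon>), for every cone
  profile g, whatever its slope at 0. It is the equality case of the three-point inequality.\<close>

lemma cone2_double: "cone2 \<beta> (2 * e) = (1 + exp (- \<beta> * e)) * cone2 \<beta> e + e * cone1 \<beta> e"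
proof (cases "\<beta> = 0")
  case False
  then have b: "\<beta> * cone2 \<beta> r = r - cone1 \<beta> r" for r
    by (simp add: cone2_def)
  have "\<beta> * ((1 + exp (- \<beta> * e)) * cone2 \<beta> e + e * cone1 \<beta> e)
      = (2 - \<beta> * cone1 \<beta> e) * (\<beta> * cone2 \<beta> e) + \<beta> * e * cone1 \<beta> e"
    unfolding exp_eq_cone1 by (simp add: algebra_simps)
  also have "\<dots> = \<beta> * cone2 \<beta> (2 * e)"
    unfolding b cone1_double exp_eq_cone1 by (simp add: algebra_simps)
  finally show ?thesis using False by simp
qed (simp add: cone1_def cone2_def power2_eq_square)

text \<open>The negated supersolution obeys an equation with - \<beta>; this factor expresses its
  error term through the same \<open>cone1 \<beta>\<close> that occurs for the subsolution.\<close>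

lemma cone1_uminus: "cone1 (- \<beta>) r = exp (\<beta> * r) * cone1 \<beta> r"
  by (auto simp: cone1_def field_simps simp flip: exp_add)

lemma cone2_asymp: "((\<lambda>e. cone2 \<beta> (2 * e) / (2 * e\<^sup>2)) \<longlongrightarrow> 1) (at_right 0)"
proof (cases "\<beta> = 0")
  case True
  then show ?thesis unfolding cone2_def cone1_def by (auto simp: power2_eq_square intro!: tendsto_eventually eventually_mono[OF eventually_at_right_less])
next
  case False
  then show ?thesis unfolding cone2_def cone1_def 
    by (simp, real_asymp, simp add: field_simps)
qed

section \<open>Cone profiles in the radius and in its square\<close>

definition cone_profile :: "real \<Rightarrow> real \<Rightarrow> real \<Rightarrow> real \<Rightarrow> real" where
  "cone_profile \<beta> a C r = a * cone1 \<beta> r - C * cone2 \<beta> r"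

text \<open>The factor 1 - \<beta> E(r) is exp (- \<beta> r); in this form \<beta> = 0 needs no
  separate case. The slope at the vertex is \<open>a\<close>.\<close>

definition cone_profile_deriv :: "real \<Rightarrow> real \<Rightarrow> real \<Rightarrow> real \<Rightarrow> real" where
  "cone_profile_deriv \<beta> a C r = a * (1 - \<beta> * cone1 \<beta> r) - C * cone1 \<beta> r"

lemma has_derivative_cone_profile [derivative_intros]:
  "(cone_profile \<beta> a C has_real_derivative cone_profile_deriv \<beta> a C r) (at r)"
  unfolding cone_profile_def[abs_def] cone_profile_deriv_def by (auto intro!: derivative_eq_intros)

lemma has_derivative_cone_profile_deriv [derivative_intros]:
  "(cone_profile_deriv \<beta> a C has_real_derivative - \<beta> * cone_profile_deriv \<beta> a C r - C) (at r)"
  unfolding cone_profile_deriv_def[abs_def]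
  by (auto intro!: derivative_eq_intros simp: algebra_simps)

lemma cone_profile_0 [simp]: "cone_profile \<beta> a C 0 = 0"
  by (simp add: cone_profile_def)

lemma continuous_on_cone_profile: "continuous_on S (cone_profile \<beta> a C)"
  by (meson DERIV_isCont continuous_at_imp_continuous_on has_derivative_cone_profile)

lemma cone_profile_less:
  assumes "r < t" "\<And>z. r < z \<Longrightarrow> z < t \<Longrightarrow> 0 < cone_profile_deriv \<beta> a C z"
  shows "cone_profile \<beta> a C r < cone_profile \<beta> a C t"
  using assms by (intro DERIV_pos_imp_increasing_open[OF assms(1)])
    (auto intro: has_derivative_cone_profile continuous_on_cone_profile)

text \<open>Dividing g' by the positive factor exp (- \<beta> r) leaves a - C E(r) / exp (- \<beta>
  r). Since \<open>a\<close> is positive, a nonpositive value forces C > 0, and then this expression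
  strictly decreases. Hence a profile that has stopped increasing never recovers.\<close>

lemma cone_profile_deriv_neg:
  assumes a: "0 < a" and r: "0 \<le> r" "r < t" and neg: "cone_profile_deriv \<beta> a C r \<le> 0"
  shows "cone_profile_deriv \<beta> a C t < 0"
proof -
  define e where "e r = 1 - \<beta> * cone1 \<beta> r" for r
  have e: "0 < e r" for r unfolding e_def using exp_eq_cone1[of \<beta> r] exp_gt_zero[of "- \<beta> * r"] by simp
  have lt: "cone1 \<beta> r < cone1 \<beta> t" by (rule cone1_strict_mono[OF r(2)])
  have "0 \<le> cone1 \<beta> r" using r(1) cone1_pos[of r \<beta>] by (cases "r = 0") auto
  have ae: "a * e r \<le> C * cone1 \<beta> r" using neg by (simp add: cone_profile_deriv_def e_def)
  moreover have "0 < a * e r" using a e by simp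
  ultimately have C: "0 < C" using \<open>0 \<le> cone1 \<beta> r\<close> by (smt (verit) mult_nonpos_nonneg)
  have "a * e r * e t \<le> C * cone1 \<beta> r * e t" using ae e[of t] by (intro mult_right_mono) auto
  \<comment> \<open>The terms containing \<beta> cancel, and what remains is C times the increment
    of \<open>cone1\<close>.\<close>
  also have "\<dots> = C * cone1 \<beta> t * e r - C * (cone1 \<beta> t - cone1 \<beta> r)"
    by (simp add: e_def algebra_simps)
  also have "\<dots> < C * cone1 \<beta> t * e r" using C lt by simp
  finally have "e r * (a * e t - C * cone1 \<beta> t) < 0" by (simp add: algebra_simps)
  then show ?thesis using e[of r] by (simp add: cone_profile_deriv_def e_def mult_less_0_iff)
qed

text \<open>The radial test functions are written in the variable s = r^2, and away from s = 0 the
  square root is smooth.\<close>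

lemma has_derivative_cone_profile_sqrt:
  assumes "0 < s"
  shows "((\<lambda>s. cone_profile \<beta> a C (sqrt s)) has_real_derivative cone_profile_deriv \<beta> a C (sqrt s) / (2 * sqrt s)) (at s)"
    and "((\<lambda>s. cone_profile_deriv \<beta> a C (sqrt s) / (2 * sqrt s)) has_real_derivative
      (- \<beta> * cone_profile_deriv \<beta> a C (sqrt s) - C) / (4 * s) - cone_profile_deriv \<beta> a C (sqrt s) / (4 * s * sqrt s)) (at s)"
proof -
  define q where "q = sqrt s"
  have q: "sqrt s = q" "s = q * q" "0 < q" using assms by (simp_all add: q_def)
  have sq: "(sqrt has_real_derivative 1 / (2 * sqrt s)) (at s)"
    using assms by (auto intro!: derivative_eq_intros simp: field_simps)
  show "((\<lambda>s. cone_profile \<beta> a C (sqrt s)) has_real_derivative cone_profile_deriv \<beta> a C (sqrt s) / (2 * sqrt s)) (at s)"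
    using DERIV_chain2[OF has_derivative_cone_profile sq] by simp
  have "((\<lambda>s. cone_profile_deriv \<beta> a C (sqrt s)) has_real_derivative (- \<beta> * cone_profile_deriv \<beta> a C (sqrt s) - C) * (1 / (2 * sqrt s))) (at s)"
    using DERIV_chain2[OF has_derivative_cone_profile_deriv sq] by simp
  from DERIV_divide[OF this DERIV_cmult[OF sq, of 2]]
  show "((\<lambda>s. cone_profile_deriv \<beta> a C (sqrt s) / (2 * sqrt s)) has_real_derivative
      (- \<beta> * cone_profile_deriv \<beta> a C (sqrt s) - C) / (4 * s) - cone_profile_deriv \<beta> a C (sqrt s) / (4 * s * sqrt s)) (at s)"
    by (rule DERIV_cong) (use q(3) in \<open>simp add: q(1), simp add: q(2) field_simps\<close>)
qed

section \<open>Radial test functions\<close>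

text \<open>Only \<open>s0\<close> needs an argument: the right difference quotient tends to
  \<open>q' s0\<close>, which is 0, and the left one is constantly 0. It serves to glue a function
  to its Taylor polynomial, at the level of values and of first derivatives.\<close>

lemma has_derivative_trunc:
  fixes q q' :: "real \<Rightarrow> real"
  assumes d: "\<And>s. s \<ge> s0 \<Longrightarrow> (q has_real_derivative q' s) (at s)"
    and 0: "q s0 = 0" "q' s0 = 0"
  shows "((\<lambda>s. if s \<le> s0 then 0 else q s) has_real_derivative (if s \<le> s0 then 0 else q' s)) (at s)"
proof -
  consider "s < s0" | "s = s0" | "s > s0" by linarith
  then show ?thesis
  proof cases
    case 1
    have "((\<lambda>s. if s \<le> s0 then 0 else q s) has_real_derivative 0) (at s)"
      by (rule has_field_derivative_transform_within_open[where S="{..<s0}" and f="\<lambda>s. 0"])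
        (use 1 in auto)
    with 1 show ?thesis by simp
  next
    case 3
    then have "(q has_real_derivative q' s) (at s)" using d by simp
    then show ?thesis
      using 3 by (auto intro: has_field_derivative_transform_within_open[where S="{s0<..}"])
  next
    case 2
    have "((\<lambda>y. (q y - q s0) / (y - s0)) \<longlongrightarrow> q' s0) (at s0)"
      using d[of s0] by (simp add: has_field_derivative_iff)
    then have "((\<lambda>y. q y / (y - s0)) \<longlongrightarrow> 0) (at_right s0)"
      using 0 by (simp add: filterlim_at_split)
    then have R: "((\<lambda>y. (if y \<le> s0 then 0 else q y) / (y - s0)) \<longlongrightarrow> 0) (at_right s0)"
      by (rule Lim_transform_eventually) (simp add: eventually_at_right_less eventually_mono[OF eventually_at_right_less])
    have "((\<lambda>y. 0) \<longlongrightarrow> (0::real)) (at_left s0)" by simp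
    then have L: "((\<lambda>y. (if y \<le> s0 then 0 else q y) / (y - s0)) \<longlongrightarrow> 0) (at_left s0)"
      by (rule Lim_transform_eventually)
        (rule eventually_mono[OF eventually_at_left_real[of "s0 - 1"]]; simp)
    show ?thesis
      using L R 2 by (simp add: has_field_derivative_iff filterlim_at_split)
  qed
qed

text \<open>The squared distance keeps the function smooth at the centre \<open>p\<close>. By the
  chain rule the Hessian is a multiple of the identity plus a rank-one form in the direction y -
  p.\<close>

lemma C2_closure_radial:
  fixes p :: "'a::euclidean_space"
  assumes F: "\<And>s. (F has_real_derivative F' s) (at s)"
    and F': "\<And>s. (F' has_real_derivative F'' s) (at s)"
    and F'': "continuous_on UNIV F''"
  shows "C2_closure \<Omega> (\<lambda>y. F ((norm (y - p))\<^sup>2)) (\<lambda>y. (2 * F' ((norm (y - p))\<^sup>2)) *\<^sub>R (y - p))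
    (\<lambda>y. (2 * F' ((norm (y - p))\<^sup>2)) *\<^sub>R id_blinfun +
         (4 * F'' ((norm (y - p))\<^sup>2)) *\<^sub>R (blinfun_scaleR_left (y - p) o\<^sub>L blinfun_inner_left (y - p)))"
proof -
  have cF: "continuous_on S (\<lambda>y. F ((norm (y - p))\<^sup>2))" for S
    by (rule continuous_on_compose2[of UNIV F]) (auto intro!: continuous_intros continuous_at_imp_continuous_on DERIV_isCont F)
  have cF': "continuous_on S (\<lambda>y. F' ((norm (y - p))\<^sup>2))" for S
    by (rule continuous_on_compose2[of UNIV F']) (auto intro!: continuous_intros continuous_at_imp_continuous_on DERIV_isCont F')
  have cF'': "continuous_on S (\<lambda>y. F'' ((norm (y - p))\<^sup>2))" for S
    by (rule continuous_on_compose2[OF F'']) (auto intro!: continuous_intros)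
  have n: "((\<lambda>y. (norm (y - p))\<^sup>2) has_derivative (\<lambda>k. 2 * ((x - p) \<bullet> k))) (at x)" for x
    unfolding power2_norm_eq_inner
    by (auto intro!: derivative_eq_intros simp: inner_commute)
  have 1: "((\<lambda>y. F ((norm (y - p))\<^sup>2)) has_derivative (\<lambda>k. (2 * F' ((norm (x - p))\<^sup>2)) *\<^sub>R (x - p) \<bullet> k)) (at x)" for x
    using has_derivative_compose[OF n F[unfolded has_field_derivative_def]]
    by (simp add: mult_ac)
  have 2: "((\<lambda>y. F' ((norm (y - p))\<^sup>2)) has_derivative (\<lambda>k. F'' ((norm (x - p))\<^sup>2) * (2 * ((x - p) \<bullet> k)))) (at x)" for x
    using has_derivative_compose[OF n F'[unfolded has_field_derivative_def]] .
  show ?thesis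
    unfolding C2_closure_def
  proof (intro conjI ballI)
    fix x
    show "((\<lambda>y. F ((norm (y - p))\<^sup>2)) has_derivative (\<lambda>k. (2 * F' ((norm (x - p))\<^sup>2)) *\<^sub>R (x - p) \<bullet> k)) (at x)"
      by (rule 1)
    show "((\<lambda>y. (2 * F' ((norm (y - p))\<^sup>2)) *\<^sub>R (y - p)) has_derivative
       blinfun_apply ((2 * F' ((norm (x - p))\<^sup>2)) *\<^sub>R id_blinfun +
         (4 * F'' ((norm (x - p))\<^sup>2)) *\<^sub>R (blinfun_scaleR_left (x - p) o\<^sub>L blinfun_inner_left (x - p)))) (at x)"
      by (rule derivative_eq_intros 2 refl | simp)+
        (auto simp: fun_eq_iff blinfun.bilinear_simps inner_commute)
  qed (intro continuous_intros cF cF' cF'')+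
qed

text \<open>For nonzero \<open>z\<close> the gradient is nonzero because \<open>c > 0\<close>, and
  \<open>z\<close> is an eigenvector of the Hessian. At \<open>z = 0\<close> the Hessian is a
  multiple of the identity, so all unit vectors give the same value and one formula covers both
  cases.\<close>

lemma inf_lap_plus_radial:
  fixes z :: "'a::euclidean_space"
  assumes "c > 0"
  shows "inf_lap_plus ((2 * c) *\<^sub>R z)
    ((2 * c) *\<^sub>R id_blinfun + (4 * d) *\<^sub>R (blinfun_scaleR_left z o\<^sub>L blinfun_inner_left z))
    = 2 * c + 4 * (norm z)\<^sup>2 * d"
proof (cases "z = 0")
  case True
  have "(\<lambda>v. blinfun_apply ((2 * c) *\<^sub>R id_blinfun) v \<bullet> v) ` sphere (0::'a) 1 = (\<lambda>v. 2 * c) ` sphere (0::'a) 1"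
    by (intro image_cong) (auto simp: blinfun.bilinear_simps dot_square_norm)
  moreover have "sphere (0::'a) 1 \<noteq> {}" by simp
  ultimately show ?thesis
    using True by (simp add: inf_lap_plus_def image_constant_conv blinfun.bilinear_simps)
next
  case False
  have "(z \<bullet> z) = (norm z)\<^sup>2" by (simp add: power2_norm_eq_inner)
  then show ?thesis
    using False assms
    by (simp add: inf_lap_plus_def blinfun.bilinear_simps inner_add_left power2_eq_square field_simps)
qed

text \<open>A cone need not be C2 at its vertex. Below \<open>s0\<close> it is replaced by its
  second-order Taylor polynomial at \<open>s0\<close>, which is stated explicitly because its values
  near the vertex have to be bounded later.\<close>

lemma C2_extension:
  fixes f f1 f2 :: "real \<Rightarrow> real"
  assumes f: "\<And>s. s0 \<le> s \<Longrightarrow> (f has_real_derivative f1 s) (at s)"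
    and f1: "\<And>s. s0 \<le> s \<Longrightarrow> (f1 has_real_derivative f2 s) (at s)"
    and f2: "continuous_on {s0..} f2"
  obtains F F' F'' where "\<And>s. (F has_real_derivative F' s) (at s)"
    "\<And>s. (F' has_real_derivative F'' s) (at s)" "continuous_on UNIV F''"
    "\<And>s. s0 \<le> s \<Longrightarrow> F s = f s \<and> F' s = f1 s \<and> F'' s = f2 s"
    "\<And>s. s \<le> s0 \<Longrightarrow> F s = f s0 + f1 s0 * (s - s0) + f2 s0 * (s - s0)\<^sup>2 / 2"
proof -
  define T where "T s = f s0 + f1 s0 * (s - s0) + f2 s0 * (s - s0)\<^sup>2 / 2" for s
  define T1 where "T1 s = f1 s0 + f2 s0 * (s - s0)" for s
  have T: "(T has_real_derivative T1 s) (at s)" for s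
    unfolding T_def[abs_def] T1_def by (auto intro!: derivative_eq_intros)
  have T1: "(T1 has_real_derivative f2 s0) (at s)" for s
    unfolding T1_def[abs_def] by (auto intro!: derivative_eq_intros)
  define F where "F s = T s + (if s \<le> s0 then 0 else f s - T s)" for s
  define F' where "F' s = T1 s + (if s \<le> s0 then 0 else f1 s - T1 s)" for s
  define F'' where "F'' s = f2 s0 + (if s \<le> s0 then 0 else f2 s - f2 s0)" for s
  have "F'' = (\<lambda>s. f2 (max s s0))" by (auto simp: F''_def fun_eq_iff max_def)
  then have "continuous_on UNIV F''"
    by (auto intro!: continuous_on_compose2[OF f2] continuous_intros)
  moreover have "(F has_real_derivative F' s) (at s)" for s
    unfolding F_def[abs_def] F'_def
    by (intro DERIV_add T has_derivative_trunc DERIV_diff f) (auto simp: T_def T1_def)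
  moreover have "(F' has_real_derivative F'' s) (at s)" for s
    unfolding F'_def[abs_def] F''_def
    by (intro DERIV_add T1 has_derivative_trunc DERIV_diff f1) (auto simp: T1_def)
  ultimately show ?thesis
    by (intro that[of F F' F'']) (auto simp: F_def F'_def F''_def T_def T1_def)
qed

section \<open>Semicontinuity and maxima over balls\<close>

lemma usc_onD: "usc_on S f \<Longrightarrow> x \<in> S \<Longrightarrow> 0 < e \<Longrightarrow> \<exists>d>0. \<forall>y\<in>S. dist y x < d \<longrightarrow> f y < f x + e"
  by (simp add: usc_on_def)

lemma usc_on_subset: "usc_on S f \<Longrightarrow> T \<subseteq> S \<Longrightarrow> usc_on T f"
  unfolding usc_on_def by (meson subsetD)

lemma usc_on_add:
  assumes "usc_on S f" "usc_on S g"
  shows "usc_on S (\<lambda>x. f x + g x)"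
  unfolding usc_on_def
proof (intro ballI allI impI)
  fix x and e :: real assume "x \<in> S" "e > 0"
  then obtain d d' where "d > 0" "\<forall>y\<in>S. dist y x < d \<longrightarrow> f y < f x + e/2"
      "d' > 0" "\<forall>y\<in>S. dist y x < d' \<longrightarrow> g y < g x + e/2"
    using usc_onD[OF assms(1), of x "e/2"] usc_onD[OF assms(2), of x "e/2"] by auto
  then show "\<exists>d>0. \<forall>y\<in>S. dist y x < d \<longrightarrow> f y + g y < f x + g x + e"
    by (intro exI[of _ "min d d'"]) (auto dest!: bspec)
qed

lemma usc_on_continuous:
  assumes "continuous_on S f"
  shows "usc_on S (f :: 'a::metric_space \<Rightarrow> real)"
  unfolding usc_on_def
proof (intro ballI allI impI)
  fix x and e :: real assume "x \<in> S" "e > 0"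
  then obtain d where "d > 0" "\<forall>y\<in>S. dist y x < d \<longrightarrow> dist (f y) (f x) < e"
    using assms unfolding continuous_on_iff by blast
  then show "\<exists>d>0. \<forall>y\<in>S. dist y x < d \<longrightarrow> f y < f x + e"
    by (intro exI[of _ d]) (auto simp: dist_real_def)
qed

lemma usc_on_sequentially:
  assumes "usc_on S f" "\<And>n. y n \<in> S" "x \<in> S" "y \<longlonglongrightarrow> x"
    and "\<And>n. c n \<le> f (y n)" "c \<longlonglongrightarrow> l"
  shows "l \<le> f x"
proof (rule field_le_epsilon)
  fix e :: real assume "e > 0"
  then obtain d where d: "d > 0" "\<forall>y\<in>S. dist y x < d \<longrightarrow> f y < f x + e"
    using usc_onD[OF assms(1,3)] by blast
  have "\<forall>\<^sub>F n in sequentially. dist (y n) x < d"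
    using assms(4) d(1) by (simp add: tendsto_iff)
  then have "\<forall>\<^sub>F n in sequentially. c n \<le> f x + e"
  proof eventually_elim
    case (elim n)
    then have "f (y n) < f x + e" using d assms(2) by blast
    then show ?case using assms(5)[of n] by linarith
  qed
  then show "l \<le> f x + e"
    using assms(6) by (intro tendsto_upperbound) auto
qed

text \<open>If no maximum existed, every x would be beaten by some z x, and f would stay below f (z
  x) near x. Among finitely many such neighbourhoods covering K, take the largest value f (z x): the
  point z x lies in one of them, so a still larger value occurs.\<close>

lemma usc_on_attains_sup:
  assumes K: "compact K" "K \<noteq> {}" and f: "usc_on K f"
  obtains x where "x \<in> K" "\<And>y. y \<in> K \<Longrightarrow> f y \<le> f x"
proof -
  have "\<exists>x\<in>K. \<forall>y\<in>K. f y \<le> f x"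
  proof (rule ccontr)
    assume "\<not> ?thesis"
    then have "\<forall>x\<in>K. \<exists>z\<in>K. f x < f z" by (auto simp: not_le)
    then obtain z where z: "\<And>x. x \<in> K \<Longrightarrow> z x \<in> K \<and> f x < f (z x)" by metis
    have "\<exists>d>0. \<forall>y\<in>K. dist y x < d \<longrightarrow> f y < f (z x)" if "x \<in> K" for x
      using usc_onD[OF f that, of "f (z x) - f x"] z[OF that] by simp
    then obtain d where d: "\<And>x. x \<in> K \<Longrightarrow> d x > 0 \<and> (\<forall>y\<in>K. dist y x < d x \<longrightarrow> f y < f (z x))"
      by metis
    have "K \<subseteq> (\<Union>x\<in>K. ball x (d x))" using d by force
    then obtain C where C: "C \<subseteq> K" "finite C" "K \<subseteq> (\<Union>x\<in>C. ball x (d x))"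
      using compactE_image[OF K(1), of K "\<lambda>x. ball x (d x)"] by auto
    then have "C \<noteq> {}" using K(2) by auto
    define m where "m = Max ((\<lambda>x. f (z x)) ` C)"
    have "m \<in> (\<lambda>x. f (z x)) ` C"
      unfolding m_def using C \<open>C \<noteq> {}\<close> by (intro Max_in) auto
    then obtain x where x: "x \<in> C" "m = f (z x)" by auto
    then obtain x' where x': "x' \<in> C" "z x \<in> ball x' (d x')"
      using C z[of x] by blast
    then have "f (z x) < f (z x')"
      using d[of x'] C(1) z[of x] x by (auto simp: dist_commute subset_iff)
    moreover have "f (z x') \<le> m"
      unfolding m_def using C x' by (intro Max_ge) auto
    ultimately show False using x by simp
  qed
  then show ?thesis using that by blast
qed

lemma closed_usc_on_superlevel:
  assumes "closed K" "usc_on K f"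
  shows "closed {x \<in> K. c \<le> f x}"
  unfolding closed_sequential_limits
proof (intro allI impI, elim conjE)
  fix y x assume y: "\<forall>n. y n \<in> {x \<in> K. c \<le> f x}" "y \<longlonglongrightarrow> x"
  moreover have "x \<in> K"
    using closed_sequentially[OF assms(1)] y by auto
  moreover have "c \<le> f x"
    by (rule usc_on_sequentially[OF assms(2) _ \<open>x \<in> K\<close> y(2), where c="\<lambda>_. c"]) (use y in auto)
  ultimately show "x \<in> {x \<in> K. c \<le> f x}" by simp
qed

section \<open>Maxima over balls and their limits for small radii\<close>

definition ball_max :: "'a::metric_space set \<Rightarrow> ('a \<Rightarrow> real) \<Rightarrow> real \<Rightarrow> 'a \<Rightarrow> real" where
  "ball_max X f r x = Sup (f ` (X \<inter> cball x r))"

locale usc_compact =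
  fixes X :: "'a::euclidean_space set" and f
  assumes compact: "compact X" and usc: "usc_on X f"
begin

lemma ball_max_attained:
  assumes "x \<in> X" "0 \<le> r"
  obtains y where "y \<in> X" "dist x y \<le> r" "ball_max X f r x = f y"
    "\<And>z. z \<in> X \<Longrightarrow> dist x z \<le> r \<Longrightarrow> f z \<le> ball_max X f r x"
proof -
  obtain y where y: "y \<in> X \<inter> cball x r" "\<And>z. z \<in> X \<inter> cball x r \<Longrightarrow> f z \<le> f y"
  proof (rule usc_on_attains_sup[of "X \<inter> cball x r" f])
    have "x \<in> X \<inter> cball x r" using assms by simp
    then show "X \<inter> cball x r \<noteq> {}" by blast
  qed (use compact usc_on_subset[OF usc] in auto)
  then have "ball_max X f r x = f y"
    unfolding ball_max_def by (intro cSup_eq_maximum) auto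
  then show ?thesis using y by (intro that[of y]) auto
qed

lemma ball_max_upper: "z \<in> X \<Longrightarrow> x \<in> X \<Longrightarrow> dist x z \<le> r \<Longrightarrow> f z \<le> ball_max X f r x"
  using order_trans[OF zero_le_dist[of x z], of r] by (auto elim!: ball_max_attained[of x r])

lemma ball_max_ge: "x \<in> X \<Longrightarrow> 0 \<le> r \<Longrightarrow> f x \<le> ball_max X f r x"
  by (rule ball_max_upper) auto

lemma ball_max_le_double:
  assumes "x \<in> X" "y \<in> X" "dist x y \<le> r"
  shows "ball_max X f r y \<le> ball_max X f (2 * r) x"
proof -
  have "0 \<le> r" using assms zero_le_dist order_trans by blast
  then obtain z where z: "z \<in> X" "dist y z \<le> r" "ball_max X f r y = f z"
    using ball_max_attained assms by metis
  then show ?thesis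
    using ball_max_upper[of z x "2 * r"] assms dist_triangle[of x z y] by auto
qed

text \<open>The midpoint between \<open>x\<close> and a maximiser in the large ball is within
  \<open>r\<close> of both, and convexity keeps it in \<open>X\<close>. This is a converse to
  \<open>ball_max_le_double\<close> for one suitable centre.\<close>

lemma ball_max_double_attained:
  assumes "x \<in> X" "0 \<le> r" "convex (X \<inter> cball x (2 * r))"
  obtains y where "y \<in> X" "dist x y \<le> r" "ball_max X f (2 * r) x \<le> ball_max X f r y"
proof -
  obtain z where z: "z \<in> X" "dist x z \<le> 2 * r" "ball_max X f (2 * r) x = f z"
    using ball_max_attained[of x "2 * r"] assms by auto
  define y where "y = midpoint x z"
  have "y = (1/2) *\<^sub>R x + (1/2) *\<^sub>R z"
    by (simp add: y_def midpoint_def scaleR_add_right)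
  then have "y \<in> X \<inter> cball x (2 * r)"
    using convexD[OF assms(3), of x z "1/2" "1/2"] assms z by auto
  then show ?thesis
    using z assms ball_max_upper[of z y r]
    by (intro that[of y]) (auto simp: y_def dist_midpoint)
qed

text \<open>Maximisers belonging to centres that converge to x accumulate at a point which competes
  in the ball about x, and semicontinuity of f carries the values to that limit.\<close>

lemma usc_on_ball_max:
  assumes "0 \<le> r"
  shows "usc_on X (ball_max X f r)"
  unfolding usc_on_def
proof (intro ballI allI impI, rule ccontr)
  fix x and e :: real
  assume x: "x \<in> X" "e > 0" and n: "\<not> (\<exists>d>0. \<forall>y\<in>X. dist y x < d \<longrightarrow> ball_max X f r y < ball_max X f r x + e)"
  have "\<exists>y\<in>X. dist y x < inverse (Suc n) \<and> ball_max X f r x + e \<le> ball_max X f r y" for n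
    using n by (meson inverse_positive_iff_positive not_le of_nat_0_less_iff zero_less_Suc)
  then obtain y where y: "\<And>n. y n \<in> X" "\<And>n. dist (y n) x < inverse (Suc n)"
      "\<And>n. ball_max X f r x + e \<le> ball_max X f r (y n)" by metis
  have "\<exists>z\<in>X. dist (y n) z \<le> r \<and> ball_max X f r (y n) = f z" for n
    using ball_max_attained[OF y(1)[of n] assms] by metis
  then obtain z where z: "\<And>n. z n \<in> X" "\<And>n. dist (y n) (z n) \<le> r" "\<And>n. ball_max X f r (y n) = f (z n)"
    by metis
  obtain l s where l: "l \<in> X" "strict_mono s" "(z \<circ> s) \<longlonglongrightarrow> l"
    using compact z(1) unfolding compact_def by metis
  have "(\<lambda>n. dist (y n) x) \<longlonglongrightarrow> 0"
    by (rule tendsto_sandwich[OF _ _ tendsto_const LIMSEQ_inverse_real_of_nat])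
      (use y(2) in \<open>auto intro!: always_eventually less_imp_le simp del: of_nat_Suc\<close>)
  then have "y \<longlonglongrightarrow> x" by (rule iffD2[OF tendsto_dist_iff])
  then have ys: "(y \<circ> s) \<longlonglongrightarrow> x" using l(2) LIMSEQ_subseq_LIMSEQ by blast
  have "dist x l \<le> r"
    by (rule tendsto_upperbound[OF tendsto_dist[OF ys l(3)]]) (use z in \<open>auto simp: o_def\<close>)
  then have "f l \<le> ball_max X f r x" using ball_max_upper l x by blast
  moreover have "ball_max X f r x + e \<le> f l"
    by (rule usc_on_sequentially[OF usc _ l(1,3), where c="\<lambda>_. ball_max X f r x + e"])
      (use z(1) y(3) z(3) in auto)
  ultimately show False using x by simp
qed

end

text \<open>The maximisers of \<open>u\<close> and \<open>w\<close> lie within the radius of the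
  common centre, so as the radii shrink all three converge, along a subsequence, to one point, where
  semicontinuity preserves the level \<open>M\<close>. The predicate \<open>P\<close> carries
  further information about the centres into the limit.\<close>

lemma ball_max_limit:
  assumes "usc_compact X u" "usc_compact X w"
    and ex: "\<And>d. 0 < d \<Longrightarrow> \<exists>e x. 0 < e \<and> e < d \<and> x \<in> X \<and> M \<le> ball_max X u e x + ball_max X w e x \<and> P e x"
  obtains x0 where "x0 \<in> X" "M \<le> u x0 + w x0"
    "\<And>d. 0 < d \<Longrightarrow> \<exists>e x. 0 < e \<and> e < d \<and> x \<in> X \<and> dist x x0 < d \<and> P e x"
proof -
  interpret u: usc_compact X u by fact
  interpret w: usc_compact X w by fact
  have "\<exists>e x y z. 0 < e \<and> e < inverse (Suc n) \<and> x \<in> X \<and> y \<in> X \<and> z \<in> X \<and> dist x y \<le> e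
      \<and> dist x z \<le> e \<and> M \<le> u y + w z \<and> P e x" for n
  proof -
    obtain e x where e: "0 < e" "e < inverse (Suc n)" "x \<in> X"
        "M \<le> ball_max X u e x + ball_max X w e x" "P e x"
      using ex[of "inverse (Suc n)"] by auto
    moreover obtain y where "y \<in> X" "dist x y \<le> e" "ball_max X u e x = u y"
      using u.ball_max_attained[of x e] e by auto
    moreover obtain z where "z \<in> X" "dist x z \<le> e" "ball_max X w e x = w z"
      using w.ball_max_attained[of x e] e by auto
    ultimately show ?thesis by auto
  qed
  then obtain e x y z where *: "\<And>n. 0 < e n" "\<And>n. e n < inverse (Suc n)"
      "\<And>n. x n \<in> X" "\<And>n. y n \<in> X" "\<And>n. z n \<in> X" "\<And>n. dist (x n) (y n) \<le> e n"
      "\<And>n. dist (x n) (z n) \<le> e n" "\<And>n. M \<le> u (y n) + w (z n)" "\<And>n. P (e n) (x n)"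
    by metis
  obtain x0 s where s: "x0 \<in> X" "strict_mono s" "(x \<circ> s) \<longlonglongrightarrow> x0"
    using u.compact *(3) unfolding compact_def by metis
  have "e \<longlonglongrightarrow> 0"
    by (rule tendsto_sandwich[OF _ _ tendsto_const LIMSEQ_inverse_real_of_nat])
      (use * in \<open>auto intro!: always_eventually less_imp_le simp del: of_nat_Suc\<close>)
  then have e0: "(e \<circ> s) \<longlonglongrightarrow> 0" using s(2) LIMSEQ_subseq_LIMSEQ by blast
  have near: "\<forall>\<^sub>F n in sequentially. e (s n) < d \<and> dist (x (s n)) x0 < d
      \<and> dist (y (s n)) x0 < d \<and> dist (z (s n)) x0 < d" if "d > 0" for d
  proof -
    have "\<forall>\<^sub>F n in sequentially. e (s n) < d/2"
      using order_tendstoD(2)[OF e0, of "d/2"] that by (simp add: o_def)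
    moreover have "\<forall>\<^sub>F n in sequentially. dist (x (s n)) x0 < d/2"
      using tendstoD[OF s(3), of "d/2"] that by (simp add: o_def)
    ultimately show ?thesis
    proof eventually_elim
      case (elim n)
      then show ?case
        using *(6,7)[of "s n"] dist_triangle[of "y (s n)" x0 "x (s n)"]
          dist_triangle[of "z (s n)" x0 "x (s n)"] that
        by (auto simp: dist_commute)
    qed
  qed
  have "M \<le> u x0 + w x0"
  proof (rule field_le_epsilon)
    fix \<eta> :: real assume "\<eta> > 0"
    then obtain d d' where d: "d > 0" "\<forall>y\<in>X. dist y x0 < d \<longrightarrow> u y < u x0 + \<eta>/2"
      "d' > 0" "\<forall>y\<in>X. dist y x0 < d' \<longrightarrow> w y < w x0 + \<eta>/2"
      using usc_onD[OF u.usc s(1), of "\<eta>/2"] usc_onD[OF w.usc s(1), of "\<eta>/2"] by auto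
    obtain n where "dist (y (s n)) x0 < min d d'" "dist (z (s n)) x0 < min d d'"
      using eventually_happens[OF near[of "min d d'"]] d by auto
    then have "u (y (s n)) < u x0 + \<eta>/2" "w (z (s n)) < w x0 + \<eta>/2"
      using d * by auto
    then show "M \<le> u x0 + w x0 + \<eta>" using *(8)[of "s n"] by simp
  qed
  moreover have "\<exists>e x. 0 < e \<and> e < d \<and> x \<in> X \<and> dist x x0 < d \<and> P e x" if "0 < d" for d
  proof -
    obtain n where "e (s n) < d" "dist (x (s n)) x0 < d"
      using eventually_happens[OF near[of d]] \<open>0 < d\<close> by auto
    with *(1,3,9)[of "s n"] show ?thesis by auto
  qed
  ultimately show ?thesis using that s(1) by blast
qed

text \<open>At the midpoint y supplied by \<open>ball_max_double_attained\<close> the maximum of u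
  is at least the doubled maximum at x, while x itself competes in the ball for w about y.
  Maximality of the sum at x links the two.\<close>

lemma discrete_step:
  assumes "usc_compact X u" "usc_compact X w" "x \<in> X" "0 \<le> r" "convex (X \<inter> cball x (2 * r))"
    and max: "\<And>y. y \<in> X \<Longrightarrow> dist x y \<le> r \<Longrightarrow>
      ball_max X u r y + ball_max X w r y \<le> ball_max X u r x + ball_max X w r x"
  shows "ball_max X u (2 * r) x - ball_max X u r x \<le> ball_max X w r x - w x"
proof -
  interpret u: usc_compact X u by fact
  interpret w: usc_compact X w by fact
  obtain y where "y \<in> X" "dist x y \<le> r" "ball_max X u (2 * r) x \<le> ball_max X u r y"
    using u.ball_max_double_attained[OF assms(3-5)] by blast
  then show ?thesis
    using max[of y] w.ball_max_upper[of x y r] \<open>x \<in> X\<close> by (simp add: dist_commute)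
qed

section \<open>Comparison with cones\<close>

locale mixed_domain =
  fixes \<Omega> \<Gamma> :: "'a::euclidean_space set" and \<nu> :: "'a \<Rightarrow> 'a"
  assumes bounded: "bounded \<Omega>" and open_\<Omega>: "open \<Omega>" and C1: "C1_boundary_normal \<Omega> \<nu>"
    and \<Gamma>: "\<Gamma> \<subseteq> frontier \<Omega>" and convex: "\<Gamma> \<noteq> {} \<Longrightarrow> convex \<Omega>"
begin

lemma compact: "compact (closure \<Omega>)"
  using bounded by (simp add: compact_closure)

text \<open>By convexity, segments from \<open>y\<close> to points of the open domain stay inside it
  after leaving \<open>y\<close>, so the defining function cannot increase along them. This gives a
  supporting half-space; openness at \<open>p\<close> makes the inequality strict.\<close>

lemma normal_pos:
  assumes y: "y \<in> \<Gamma>" and p: "p \<in> \<Omega>"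
  shows "0 < (y - p) \<bullet> \<nu> y"
proof -
  have yf: "y \<in> frontier \<Omega>" "y \<notin> \<Omega>" "y \<in> closure \<Omega>" and cv: "convex \<Omega>"
    using y \<Gamma> convex open_\<Omega> by (auto simp: frontier_def interior_open)
  obtain r \<psi> D where r: "r > 0"
    and D: "\<forall>z\<in>ball y r. (\<psi> has_derivative (\<lambda>k. D z \<bullet> k)) (at z) \<and> D z \<noteq> 0"
    and \<psi>: "\<Omega> \<inter> ball y r = {z \<in> ball y r. \<psi> z < 0}" and \<nu>: "\<nu> y = D y /\<^sub>R norm (D y)"
    using bspec[OF C1[unfolded C1_boundary_normal_def] yf(1)] by blast
  have Dy: "(\<psi> has_derivative (\<lambda>k. D y \<bullet> k)) (at y)" "D y \<noteq> 0" using D r by auto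
  have \<psi>y: "0 \<le> \<psi> y"
  proof (rule ccontr)
    assume "\<not> 0 \<le> \<psi> y"
    then have "y \<in> \<Omega> \<inter> ball y r" using r unfolding \<psi> by simp
    then show False using yf by simp
  qed
  have nonpos: "D y \<bullet> (q - y) \<le> 0" if q: "q \<in> \<Omega>" for q
  proof (rule ccontr)
    assume "\<not> ?thesis"
    then have pos: "0 < D y \<bullet> (q - y)" by simp
    have "((\<lambda>t. \<psi> (y + t *\<^sub>R (q - y))) has_derivative (\<lambda>t. D y \<bullet> (t *\<^sub>R (q - y)))) (at 0)"
      by (rule has_derivative_compose[where g=\<psi> and f="\<lambda>t. y + t *\<^sub>R (q - y)"])
        (use Dy in \<open>auto intro!: derivative_eq_intros\<close>)
    then have "((\<lambda>t. \<psi> (y + t *\<^sub>R (q - y))) has_real_derivative D y \<bullet> (q - y)) (at 0)"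
      by (simp add: has_field_derivative_def mult_commute_abs)
    from DERIV_pos_inc_right[OF this pos]
    obtain d where d: "d > 0" "\<And>t. 0 < t \<Longrightarrow> t < d \<Longrightarrow> \<psi> y < \<psi> (y + t *\<^sub>R (q - y))" by auto
    \<comment> \<open>Small enough for the increase of \<psi>, for a point on the segment, and for
      staying in the ball where \<psi> describes the domain.\<close>
    define t where "t = min (min (d/2) 1) (r / (2 * norm (q - y)))"
    have qy: "q \<noteq> y" using q yf by auto
    then have t: "0 < t" "t < d" "t \<le> 1" "t \<le> r / (2 * norm (q - y))"
      using d r by (auto simp: t_def)
    then have "t * norm (q - y) \<le> r / 2" using qy by (simp add: field_simps)
    then have "y + t *\<^sub>R (q - y) \<in> ball y r" using t r by (simp add: dist_norm)
    moreover have "y - t *\<^sub>R (y - q) \<in> interior \<Omega>"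
      using cv q yf t open_\<Omega> by (intro mem_interior_closure_convex_shrink) (auto simp: interior_open)
    then have "y + t *\<^sub>R (q - y) \<in> \<Omega>"
      using open_\<Omega> by (simp add: interior_open algebra_simps)
    ultimately have "\<psi> (y + t *\<^sub>R (q - y)) < 0" using \<psi> by blast
    then show False using d(2)[OF t(1,2)] \<psi>y by simp
  qed
  \<comment> \<open>Strictness: shifting \<open>p\<close> by a small multiple of the gradient stays
    in the domain, and the weak inequality at the shifted point leaves the margin
    \<open>c * (D y \<bullet> D y)\<close>.\<close>
  obtain e where e: "e > 0" "cball p e \<subseteq> \<Omega>" using open_\<Omega> p open_contains_cball by blast
  define c where "c = e / norm (D y)"
  have c: "c > 0" using e Dy by (simp add: c_def)
  have "p + c *\<^sub>R D y \<in> cball p e" using e Dy by (simp add: c_def dist_norm)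
  then have "D y \<bullet> (p + c *\<^sub>R D y - y) \<le> 0" using nonpos e by blast
  then have "c * (D y \<bullet> D y) \<le> D y \<bullet> (y - p)" by (simp add: algebra_simps)
  moreover have "0 < c * (D y \<bullet> D y)" using c Dy by simp
  ultimately have "0 < D y \<bullet> (y - p)" by linarith
  then show ?thesis using Dy by (simp add: \<nu> inner_commute)
qed

text \<open>A radial strict supersolution on the shell s1 < |y - x|^2 < s2 cannot touch
  \<open>u\<close> from above there. The hypothesis \<open>touch\<close> confines maximum points of
  the difference to the shell. A negative \<open>s1\<close> turns the shell into a full
  ball.\<close>

lemma no_radial_touching:
  assumes sub: "viscosity_subsolution \<Omega> \<Gamma> \<nu> \<beta> h u"
    and x: "x \<in> closure \<Omega>" and K: "closure \<Omega> \<inter> cball x \<rho> \<subseteq> \<Omega> \<union> \<Gamma>"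
    and h: "\<And>y. y \<in> closure \<Omega> \<Longrightarrow> dist x y \<le> \<rho> \<Longrightarrow> h y \<le> c"
    and F: "\<And>s. (F has_real_derivative F' s) (at s)"
    and F': "\<And>s. (F' has_real_derivative F'' s) (at s)"
    and F'': "continuous_on UNIV F''"
    and \<rho>: "0 < \<rho>" "s2 \<le> \<rho>\<^sup>2"
    and strict: "\<And>s. 0 \<le> s \<Longrightarrow> s1 < s \<Longrightarrow> s < s2 \<Longrightarrow>
      0 < F' s \<and> c < - (2 * F' s + 4 * s * F'' s) - 2 * \<beta> * F' s * sqrt s"
    and z: "z \<in> closure \<Omega>" "dist x z \<le> \<rho>"
    and touch: "\<And>y. y \<in> closure \<Omega> \<Longrightarrow> dist x y \<le> \<rho> \<Longrightarrow>
      (norm (y - x))\<^sup>2 \<le> s1 \<or> s2 \<le> (norm (y - x))\<^sup>2 \<Longrightarrow>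
      u y - F ((norm (y - x))\<^sup>2) < u z - F ((norm (z - x))\<^sup>2)"
  shows False
proof -
  define K where "K = closure \<Omega> \<inter> cball x \<rho>"
  have Kc: "compact K" "z \<in> K" unfolding K_def using compact z by auto
  have usc: "usc_on K u"
    using sub unfolding viscosity_subsolution_def K_def by (auto intro: usc_on_subset)
  have cF: "isCont F s" for s using F DERIV_isCont by blast
  \<comment> \<open>The vertex is approximated from the open domain because
    \<open>normal_pos\<close> requires a vertex there; \<open>x\<close> itself may lie on the
    boundary.\<close>
  obtain X where X: "\<And>n. X n \<in> \<Omega>" "X \<longlonglongrightarrow> x" using x closure_sequential by metis
  have "\<exists>y\<in>K. \<forall>w\<in>K. u w - F ((norm (w - X n))\<^sup>2) \<le> u y - F ((norm (y - X n))\<^sup>2)" for n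
  proof -
    have "continuous_on K (\<lambda>y. - F ((norm (y - X n))\<^sup>2))"
      by (intro continuous_intros continuous_on_compose2[where f="\<lambda>y. (norm (y - X n))\<^sup>2" and t=UNIV and g=F])
        (auto intro: continuous_at_imp_continuous_on cF)
    then have "usc_on K (\<lambda>y. u y + - F ((norm (y - X n))\<^sup>2))"
      by (intro usc_on_add usc usc_on_continuous)
    from usc_on_attains_sup[OF Kc(1) _ this] Kc(2) obtain y
      where "y \<in> K" "\<And>w. w \<in> K \<Longrightarrow> u w + - F ((norm (w - X n))\<^sup>2) \<le> u y + - F ((norm (y - X n))\<^sup>2)"
      by blast
    then show ?thesis by auto
  qed
  then obtain Y where Y: "\<And>n. Y n \<in> K"
    "\<And>n w. w \<in> K \<Longrightarrow> u w - F ((norm (w - X n))\<^sup>2) \<le> u (Y n) - F ((norm (Y n - X n))\<^sup>2)"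
    by metis
  obtain l s where l: "l \<in> K" "strict_mono s" "(Y \<circ> s) \<longlonglongrightarrow> l"
    using Kc(1) Y(1) unfolding compact_def by metis
  have Xs: "(X \<circ> s) \<longlonglongrightarrow> x" using LIMSEQ_subseq_LIMSEQ X(2) l(2) by blast
  have lim: "(\<lambda>n. (norm ((Y \<circ> s) n - (X \<circ> s) n))\<^sup>2) \<longlonglongrightarrow> (norm (l - x))\<^sup>2"
    by (intro tendsto_intros l Xs)
  have "u z - F ((norm (z - x))\<^sup>2) + F ((norm (l - x))\<^sup>2) \<le> u l"
  proof (rule usc_on_sequentially[OF usc _ l(1,3)])
    show "(Y \<circ> s) n \<in> K" for n using Y by simp
    show "u z - F ((norm (z - (X \<circ> s) n))\<^sup>2) + F ((norm ((Y \<circ> s) n - (X \<circ> s) n))\<^sup>2) \<le> u ((Y \<circ> s) n)" for n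
      using Y(2)[OF Kc(2), of "s n"] by simp
    show "(\<lambda>n. u z - F ((norm (z - (X \<circ> s) n))\<^sup>2) + F ((norm ((Y \<circ> s) n - (X \<circ> s) n))\<^sup>2))
      \<longlonglongrightarrow> u z - F ((norm (z - x))\<^sup>2) + F ((norm (l - x))\<^sup>2)"
      by (intro tendsto_add tendsto_diff tendsto_const isCont_tendsto_compose[OF cF] lim
          tendsto_power tendsto_norm Xs)
  qed
  then have ls: "s1 < (norm (l - x))\<^sup>2" "(norm (l - x))\<^sup>2 < s2"
    using touch[of l] l(1) unfolding K_def by force+
  have lim2: "(\<lambda>n. (norm ((Y \<circ> s) n - x))\<^sup>2) \<longlonglongrightarrow> (norm (l - x))\<^sup>2"
    by (intro tendsto_intros l)
  have "\<forall>\<^sub>F n in sequentially. s1 < (norm (Y (s n) - X (s n)))\<^sup>2 \<and> (norm (Y (s n) - X (s n)))\<^sup>2 < s2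
     \<and> (norm (Y (s n) - x))\<^sup>2 < s2"
    using order_tendstoD(1)[OF lim ls(1)] order_tendstoD(2)[OF lim ls(2)] order_tendstoD(2)[OF lim2 ls(2)]
    by eventually_elim auto
  then obtain n where "s1 < (norm (Y (s n) - X (s n)))\<^sup>2" "(norm (Y (s n) - X (s n)))\<^sup>2 < s2"
     "(norm (Y (s n) - x))\<^sup>2 < s2" using eventually_happens by fastforce
  moreover define p y where "p = X (s n)" and "y = Y (s n)"
  ultimately have s: "s1 < (norm (y - p))\<^sup>2" "(norm (y - p))\<^sup>2 < s2" "(norm (y - x))\<^sup>2 < s2"
    by auto
  have p: "p \<in> \<Omega>" and y: "y \<in> closure \<Omega>" "dist x y \<le> \<rho>" "y \<in> \<Omega> \<union> \<Gamma>"
    using X Y(1)[of "s n"] assms(3) by (auto simp: K_def p_def y_def)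
  have "(norm (y - x))\<^sup>2 < \<rho>\<^sup>2" using s \<rho> by simp
  then have "dist x y < \<rho>"
    using \<rho> by (simp add: dist_norm norm_minus_commute power2_less_imp_less)
  \<comment> \<open>The point is strictly inside the ball, so the maximum over \<open>K\<close> is a
    local maximum relative to the whole closure.\<close>
  then have "local_max_rel (closure \<Omega>) (\<lambda>w. u w - F ((norm (w - p))\<^sup>2)) y"
    unfolding local_max_rel_def
  proof (intro exI[of _ "\<rho> - dist x y"] conjI ballI impI)
    fix w assume "w \<in> closure \<Omega>" "dist w y < \<rho> - dist x y"
    then have "w \<in> K" using dist_triangle[of x w y] by (auto simp: K_def dist_commute)
    then show "u w - F ((norm (w - p))\<^sup>2) \<le> u y - F ((norm (y - p))\<^sup>2)"
      using Y(2) by (simp add: p_def y_def)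
  qed simp
  with sub C2_closure_radial[OF F F' F'', of \<Omega> p] y(3)
  have visc: "- inf_lap_plus ((2 * F' ((norm (y - p))\<^sup>2)) *\<^sub>R (y - p))
     ((2 * F' ((norm (y - p))\<^sup>2)) *\<^sub>R id_blinfun +
         (4 * F'' ((norm (y - p))\<^sup>2)) *\<^sub>R (blinfun_scaleR_left (y - p) o\<^sub>L blinfun_inner_left (y - p)))
     - \<beta> * norm ((2 * F' ((norm (y - p))\<^sup>2)) *\<^sub>R (y - p)) \<le> h y \<or>
     y \<in> \<Gamma> \<and> (2 * F' ((norm (y - p))\<^sup>2)) *\<^sub>R (y - p) \<bullet> \<nu> y \<le> 0"
    unfolding viscosity_subsolution_def by blast
  note st = strict[OF zero_le_power2 s(1,2)]
  from visc show False
  proof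
    assume "y \<in> \<Gamma> \<and> (2 * F' ((norm (y - p))\<^sup>2)) *\<^sub>R (y - p) \<bullet> \<nu> y \<le> 0"
    \<comment> \<open>The gradient is a positive multiple of y - p, hence strictly outward.\<close>
    then show False using normal_pos[of y p] p st by (simp add: mult_le_0_iff)
  next
    assume *: "- inf_lap_plus ((2 * F' ((norm (y - p))\<^sup>2)) *\<^sub>R (y - p))
     ((2 * F' ((norm (y - p))\<^sup>2)) *\<^sub>R id_blinfun +
         (4 * F'' ((norm (y - p))\<^sup>2)) *\<^sub>R (blinfun_scaleR_left (y - p) o\<^sub>L blinfun_inner_left (y - p)))
     - \<beta> * norm ((2 * F' ((norm (y - p))\<^sup>2)) *\<^sub>R (y - p)) \<le> h y"
    have "inf_lap_plus ((2 * F' ((norm (y - p))\<^sup>2)) *\<^sub>R (y - p))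
     ((2 * F' ((norm (y - p))\<^sup>2)) *\<^sub>R id_blinfun +
         (4 * F'' ((norm (y - p))\<^sup>2)) *\<^sub>R (blinfun_scaleR_left (y - p) o\<^sub>L blinfun_inner_left (y - p)))
      = 2 * F' ((norm (y - p))\<^sup>2) + 4 * (norm (y - p))\<^sup>2 * F'' ((norm (y - p))\<^sup>2)"
      using st by (intro inf_lap_plus_radial) auto
    moreover have "norm ((2 * F' ((norm (y - p))\<^sup>2)) *\<^sub>R (y - p)) = 2 * F' ((norm (y - p))\<^sup>2) * sqrt ((norm (y - p))\<^sup>2)"
      using st by simp
    ultimately show False
      using * st h[OF y(1,2)] by (simp add: mult.assoc mult.left_commute)
  qed
qed

end

section \<open>Cone comparison and the three-point inequality\<close>

context mixed_domain
begin

lemma usc_compact: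
  assumes "viscosity_subsolution \<Omega> \<Gamma> \<nu> \<beta> h u"
  shows "usc_compact (closure \<Omega>) u"
  using assms compact by unfold_locales (simp_all add: viscosity_subsolution_def)

text \<open>As \<open>C\<close> exceeds \<open>c\<close>, the increasing profile is a strict
  supersolution off the vertex. A violation by \<delta> at \<open>z\<close> survives smoothing of
  the tip, since near the vertex \<open>u\<close> exceeds u x by less than half of \<delta> and the
  smoothed cone stays above minus half of \<delta>; the sphere is handled by
  \<open>bd\<close>.\<close>

lemma cone_comparison:
  assumes sub: "viscosity_subsolution \<Omega> \<Gamma> \<nu> \<beta> h u"
    and x: "x \<in> closure \<Omega>" and K: "closure \<Omega> \<inter> cball x \<rho> \<subseteq> \<Omega> \<union> \<Gamma>"
    and h: "\<And>y. y \<in> closure \<Omega> \<Longrightarrow> dist x y \<le> \<rho> \<Longrightarrow> h y \<le> c" and "c < C" and "0 < \<rho>"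
    and pos: "\<And>r. 0 \<le> r \<Longrightarrow> r < \<rho> \<Longrightarrow> 0 < cone_profile_deriv \<beta> a C r"
    and bd: "\<And>y. y \<in> closure \<Omega> \<Longrightarrow> dist x y = \<rho> \<Longrightarrow> u y \<le> u x + cone_profile \<beta> a C \<rho>"
    and z: "z \<in> closure \<Omega>" "dist x z < \<rho>"
  shows "u z \<le> u x + cone_profile \<beta> a C (dist x z)"
proof (rule ccontr)
  let ?g = "cone_profile \<beta> a C" and ?g' = "cone_profile_deriv \<beta> a C"
  let ?g'' = "\<lambda>r. - \<beta> * ?g' r - C"
  define \<delta> where "\<delta> = u z - u x - ?g (dist x z)"
  assume "\<not> ?thesis"
  then have \<delta>: "\<delta> > 0" by (simp add: \<delta>_def)
  interpret usc_compact "closure \<Omega>" u by (rule usc_compact[OF sub])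
  obtain d1 where d1: "d1 > 0" "\<And>y. y \<in> closure \<Omega> \<Longrightarrow> dist y x < d1 \<Longrightarrow> u y < u x + \<delta> / 2"
    using usc_onD[OF usc x, of "\<delta> / 2"] \<delta> by auto
  \<comment> \<open>A lower bound for the Taylor continuation glued at s = r^2, taken over all
    smaller s; it tends to 0 with r, which fixes the gluing radius \<open>r0\<close>.\<close>
  define k where "k r = ?g r - \<bar>?g' r * r / 2\<bar> - \<bar>?g'' r * r * r / 4 - ?g' r * r / 4\<bar> / 2" for r
  have "isCont ?g 0" "isCont ?g' 0"
    using has_derivative_cone_profile has_derivative_cone_profile_deriv DERIV_isCont by blast+
  then have "isCont k 0" unfolding k_def[abs_def] by (intro continuous_intros) auto
  moreover have "k 0 = 0" by (simp add: k_def)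
  ultimately have "\<exists>d>0. \<forall>r. \<bar>r\<bar> < d \<longrightarrow> \<bar>k r\<bar> < \<delta> / 2"
    using spec[of "\<lambda>e. 0 < e \<longrightarrow> (\<exists>d>0. \<forall>r. \<bar>r\<bar> < d \<longrightarrow> \<bar>k r\<bar> < e)" "\<delta> / 2"] \<delta>
    unfolding continuous_at_real_range by (simp del: less_divide_eq_numeral1)
  then obtain d2 where d2: "d2 > 0" "\<And>r. \<bar>r\<bar> < d2 \<Longrightarrow> \<bar>k r\<bar> < \<delta> / 2" by blast
  define r0 where "r0 = min (min d1 d2) \<rho> / 2"
  have r0: "0 < r0" "r0 < d1" "r0 < d2" "r0 < \<rho>"
    using d1 d2 \<open>0 < \<rho>\<close> by (auto simp: r0_def)
  define s0 where "s0 = r0\<^sup>2"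
  have s0: "0 < s0" "sqrt s0 = r0" using r0 by (auto simp: s0_def)
  define f where "f s = ?g (sqrt s)" for s
  define f1 where "f1 s = ?g' (sqrt s) / (2 * sqrt s)" for s
  define f2 where "f2 s = ?g'' (sqrt s) / (4 * s) - ?g' (sqrt s) / (4 * s * sqrt s)" for s
  have f: "(f has_real_derivative f1 s) (at s)" "(f1 has_real_derivative f2 s) (at s)" if "s0 \<le> s" for s
    using has_derivative_cone_profile_sqrt[of s \<beta> a C] s0 that unfolding f_def[abs_def] f1_def[abs_def] f2_def by auto
  have "continuous_on UNIV ?g'"
    by (meson DERIV_isCont continuous_at_imp_continuous_on has_derivative_cone_profile_deriv)
  then have "continuous_on {s0..} (\<lambda>s. ?g' (sqrt s))"
    by (rule continuous_on_compose2) (auto intro!: continuous_intros)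
  then have cf2: "continuous_on {s0..} f2"
    unfolding f2_def[abs_def] using s0 by (intro continuous_intros) auto
  obtain F F' F'' where F: "\<And>s. (F has_real_derivative F' s) (at s)"
    "\<And>s. (F' has_real_derivative F'' s) (at s)" "continuous_on UNIV F''"
    "\<And>s. s0 \<le> s \<Longrightarrow> F s = f s \<and> F' s = f1 s \<and> F'' s = f2 s"
    "\<And>s. s \<le> s0 \<Longrightarrow> F s = f s0 + f1 s0 * (s - s0) + f2 s0 * (s - s0)\<^sup>2 / 2"
    by (rule C2_extension[OF f(1) f(2) cf2]; (rule that)?; assumption)
  have low: "- \<delta> / 2 < F s" if "0 \<le> s" "s \<le> s0" for s
  proof -
    have "\<bar>f1 s0 * (s - s0)\<bar> \<le> \<bar>f1 s0\<bar> * s0"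
      unfolding abs_mult using that by (intro mult_left_mono) auto
    also have "\<dots> = \<bar>?g' r0 * r0 / 2\<bar>"
      using s0 r0 by (simp add: f1_def s0_def power2_eq_square abs_mult)
    finally have 1: "\<bar>f1 s0 * (s - s0)\<bar> \<le> \<bar>?g' r0 * r0 / 2\<bar>" .
    have "\<bar>f2 s0 * (s - s0)\<^sup>2\<bar> \<le> \<bar>f2 s0\<bar> * s0\<^sup>2"
      unfolding abs_mult using that s0 by (intro mult_left_mono) (auto simp: power2_le_iff_abs_le)
    also have "\<dots> = \<bar>f2 s0 * s0\<^sup>2\<bar>" by (simp add: abs_mult)
    also have "f2 s0 * s0\<^sup>2 = ?g'' r0 * r0 * r0 / 4 - ?g' r0 * r0 / 4"
      using s0 r0 by (simp add: f2_def s0_def power2_eq_square field_simps)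
    finally have 2: "\<bar>f2 s0 * (s - s0)\<^sup>2\<bar> \<le> \<bar>?g'' r0 * r0 * r0 / 4 - ?g' r0 * r0 / 4\<bar>" .
    have "g - b - b' / 2 \<le> v" if "v = g + w + w' / 2" "- w \<le> b" "- w' \<le> b'" for g b b' v w w' :: real
      using that by simp
    from this[OF F(5)[OF that(2), unfolded f_def s0(2)] abs_le_D2[OF 1] abs_le_D2[OF 2]]
    have "k r0 \<le> F s" unfolding k_def .
    then show ?thesis using d2(2)[of r0] r0 by linarith
  qed
  \<comment> \<open>The violating point lies outside the smoothed tip, where the test function is
    still the original cone.\<close>
  have rz: "r0 \<le> dist x z"
  proof (rule ccontr)
    assume "\<not> ?thesis"
    then have "u z < u x + \<delta> / 2" using d1 r0 z by (simp add: dist_commute)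
    moreover have "0 \<le> ?g (dist x z)"
    proof (cases "x = z")
      case False
      then show ?thesis using cone_profile_less[of 0 "dist x z" \<beta> a C] pos z by (simp add: less_imp_le)
    qed simp
    ultimately show False using \<delta> \<delta>_def by linarith
  qed
  have Fz: "F ((norm (z - x))\<^sup>2) = ?g (dist x z)"
  proof -
    have "s0 \<le> (norm (z - x))\<^sup>2"
      unfolding s0_def using rz r0 by (intro power_mono) (auto simp: dist_norm norm_minus_commute)
    then show ?thesis using F(4) by (simp add: f_def dist_norm norm_minus_commute)
  qed
  show False
  proof (rule no_radial_touching[OF sub x K h F(1,2,3) \<open>0 < \<rho>\<close> order_refl _ z(1)])
    show "0 < F' s \<and> c < - (2 * F' s + 4 * s * F'' s) - 2 * \<beta> * F' s * sqrt s"
      if s: "0 \<le> s" "s0 < s" "s < \<rho>\<^sup>2" for s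
    proof -
      have "sqrt s < \<rho>" using s \<open>0 < \<rho>\<close> by (simp add: real_less_lsqrt)
      then have p: "0 < ?g' (sqrt s)" using pos s by simp
      have s_pos: "0 < s" "sqrt s \<noteq> 0" using s s0 by auto
      have Fs: "F' s = f1 s" "F'' s = f2 s" using F(4)[of s] s by auto
      \<comment> \<open>In terms of the radius the second-order part is g''. The strict inequality
        thus reads c < - g'' - \<beta> g', and the right side is C.\<close>
      have "2 * F' s + 4 * s * F'' s = ?g'' (sqrt s)"
        unfolding Fs f1_def f2_def using s_pos by (simp add: field_simps)
      moreover have "2 * \<beta> * F' s * sqrt s = \<beta> * ?g' (sqrt s)"
        using F(4)[of s] s s_pos by (simp add: f1_def)
      moreover have "0 < F' s" using F(4)[of s] s s_pos p by (simp add: f1_def)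
      ultimately show ?thesis using \<open>c < C\<close> by (intro conjI; linarith)
    qed
    show "dist x z \<le> \<rho>" using z by simp
    fix y assume y: "y \<in> closure \<Omega>" "dist x y \<le> \<rho>" "(norm (y - x))\<^sup>2 \<le> s0 \<or> \<rho>\<^sup>2 \<le> (norm (y - x))\<^sup>2"
    from y(3) show "u y - F ((norm (y - x))\<^sup>2) < u z - F ((norm (z - x))\<^sup>2)"
    proof
      assume l: "(norm (y - x))\<^sup>2 \<le> s0"
      then have "norm (y - x) \<le> r0" using r0 by (simp add: s0_def power2_le_iff_abs_le)
      then have "u y < u x + \<delta> / 2" using d1 y r0 by (simp add: dist_norm)
      moreover have "- \<delta> / 2 < F ((norm (y - x))\<^sup>2)" using low l by simp
      ultimately show ?thesis unfolding Fz using \<delta>_def by linarith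
    next
      assume "\<rho>\<^sup>2 \<le> (norm (y - x))\<^sup>2"
      then have "\<rho> \<le> norm (y - x)" by (rule power2_le_imp_le[OF _ norm_ge_zero])
      then have e: "norm (y - x) = \<rho>" "dist x y = \<rho>" using y by (auto simp: dist_norm norm_minus_commute)
      have "s0 \<le> \<rho>\<^sup>2" unfolding s0_def using r0 by (intro power_mono) auto
      then have "F (\<rho>\<^sup>2) = ?g \<rho>" using F(4) \<open>0 < \<rho>\<close> by (simp add: f_def)
      then show ?thesis using bd[OF y(1) e(2)] \<delta> unfolding Fz e using \<delta>_def by linarith
    qed
  qed
qed

text \<open>For \<open>C < 0\<close> the slope of the comparison cone could a priori be negative; a paraboloid
  touching at the vertex itself excludes this when \<open>\<epsilon>\<close> is small.\<close>

lemma cone_slope_nonneg: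
  assumes sub: "viscosity_subsolution \<Omega> \<Gamma> \<nu> \<beta> h u"
    and x: "x \<in> closure \<Omega>" and K: "closure \<Omega> \<inter> cball x (2 * \<epsilon>) \<subseteq> \<Omega> \<union> \<Gamma>" and "0 < \<epsilon>"
    and h: "\<And>y. y \<in> closure \<Omega> \<Longrightarrow> dist x y \<le> 2 * \<epsilon> \<Longrightarrow> h y \<le> c"
    and small: "C < 0 \<Longrightarrow> - C * cone2 \<beta> (2 * \<epsilon>) * (1 + 2 * \<bar>\<beta>\<bar> * \<epsilon>) < - c * (2 * \<epsilon>\<^sup>2)"
  shows "0 \<le> ball_max (closure \<Omega>) u (2 * \<epsilon>) x - u x + C * cone2 \<beta> (2 * \<epsilon>)"
proof (rule ccontr)
  interpret usc_compact "closure \<Omega>" u by (rule usc_compact[OF sub])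
  assume neg: "\<not> ?thesis"
  have P: "0 < cone2 \<beta> (2 * \<epsilon>)" using \<open>0 < \<epsilon>\<close> by (simp add: cone2_pos)
  have "u x \<le> ball_max (closure \<Omega>) u (2 * \<epsilon>) x" using ball_max_ge[OF x] \<open>0 < \<epsilon>\<close> by simp
  with neg have "C * cone2 \<beta> (2 * \<epsilon>) < 0" by linarith
  then have C: "C < 0" using P by (simp add: mult_less_0_iff)
  \<comment> \<open>Chosen so that the paraboloid with coefficient D / 2 takes the value - C P(2
    \<epsilon>) at distance 2 \<epsilon>, where P is \<open>cone2 \<beta>\<close>; the negated claim
    places the increment of \<open>u\<close> below this value.\<close>
  define D where "D = - C * cone2 \<beta> (2 * \<epsilon>) / (2 * \<epsilon>\<^sup>2)"
  have D: "0 < D" "D * (2 * \<epsilon>\<^sup>2) = - C * cone2 \<beta> (2 * \<epsilon>)"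
    using C P \<open>0 < \<epsilon>\<close> by (auto simp: D_def divide_neg_pos mult_neg_pos)
  have "(D * (1 + 2 * \<bar>\<beta>\<bar> * \<epsilon>)) * (2 * \<epsilon>\<^sup>2) = (D * (2 * \<epsilon>\<^sup>2)) * (1 + 2 * \<bar>\<beta>\<bar> * \<epsilon>)"
    by (simp only: mult_ac)
  also have "\<dots> < - c * (2 * \<epsilon>\<^sup>2)"
    unfolding D(2) by (rule small[OF C])
  finally have "(D * (1 + 2 * \<bar>\<beta>\<bar> * \<epsilon>)) * (2 * \<epsilon>\<^sup>2) < - c * (2 * \<epsilon>\<^sup>2)" .
  then have Dc: "D * (1 + 2 * \<bar>\<beta>\<bar> * \<epsilon>) < - c"
    by (rule mult_right_less_imp_less) simp
  show False
  \<comment> \<open>With \<open>s1\<close> equal to -1 the vertex, where the gradient vanishes, is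
    an admissible touching point.\<close>
  proof (rule no_radial_touching[OF sub x K h, where F="\<lambda>s. D / 2 * s" and F'="\<lambda>s. D / 2" and F''="\<lambda>s. 0"
        and ?s1.0="-1" and ?s2.0="(2 * \<epsilon>)\<^sup>2" and z=x])
    fix s assume s: "0 \<le> s" "s < (2 * \<epsilon>)\<^sup>2"
    then have "sqrt s \<le> 2 * \<epsilon>" using \<open>0 < \<epsilon>\<close> by (simp add: real_le_lsqrt)
    then have "\<beta> * sqrt s \<le> 2 * \<bar>\<beta>\<bar> * \<epsilon>"
      using mult_mono[OF abs_ge_self[of \<beta>], of "sqrt s" "2 * \<epsilon>"] s by (simp add: mult_ac)
    then have "D * (1 + \<beta> * sqrt s) \<le> D * (1 + 2 * \<bar>\<beta>\<bar> * \<epsilon>)"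
      using D by (intro mult_left_mono) auto
    then have "D * (1 + \<beta> * sqrt s) < - c" using Dc by linarith
    moreover have "D * (1 + \<beta> * sqrt s) = 2 * (D / 2) + 2 * \<beta> * (D / 2) * sqrt s"
      by (simp add: algebra_simps)
    ultimately show "0 < D / 2 \<and> c < - (2 * (D / 2) + 4 * s * 0) - 2 * \<beta> * (D / 2) * sqrt s"
      using D(1) by (intro conjI; linarith)
  next
    fix y assume y: "y \<in> closure \<Omega>" "dist x y \<le> 2 * \<epsilon>" "(norm (y - x))\<^sup>2 \<le> - 1 \<or> (2 * \<epsilon>)\<^sup>2 \<le> (norm (y - x))\<^sup>2"
    then have "(2 * \<epsilon>)\<^sup>2 \<le> (norm (y - x))\<^sup>2" using zero_le_power2[of "norm (y - x)"] by linarith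
    then have "D / 2 * (2 * \<epsilon>)\<^sup>2 \<le> D / 2 * (norm (y - x))\<^sup>2" using D by (intro mult_left_mono) auto
    moreover have "D / 2 * (2 * \<epsilon>)\<^sup>2 = D * (2 * \<epsilon>\<^sup>2)" by (simp add: power2_eq_square)
    moreover have "u y \<le> ball_max (closure \<Omega>) u (2 * \<epsilon>) x" using y x by (intro ball_max_upper) auto
    moreover have "D / 2 * (norm (x - x))\<^sup>2 = 0" by simp
    ultimately show "u y - D / 2 * (norm (y - x))\<^sup>2 < u x - D / 2 * (norm (x - x))\<^sup>2"
      using neg D(2) by linarith
  qed (use \<open>0 < \<epsilon>\<close> x in \<open>auto intro!: derivative_eq_intros continuous_intros\<close>)
qed

text \<open>The profile that interpolates 0 at the vertex and the increment of \<open>u\<close> at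
  radius 2 \<epsilon> dominates the increment at radius \<epsilon>; the doubling identities convert
  this into the claim.\<close>

lemma discrete_subsolution:
  assumes sub: "viscosity_subsolution \<Omega> \<Gamma> \<nu> \<beta> h u"
    and x: "x \<in> closure \<Omega>" and K: "closure \<Omega> \<inter> cball x (2 * \<epsilon>) \<subseteq> \<Omega> \<union> \<Gamma>" and "0 < \<epsilon>"
    and h: "\<And>y. y \<in> closure \<Omega> \<Longrightarrow> dist x y \<le> 2 * \<epsilon> \<Longrightarrow> h y \<le> c" and "c < C"
    and small: "C < 0 \<Longrightarrow> - C * cone2 \<beta> (2 * \<epsilon>) * (1 + 2 * \<bar>\<beta>\<bar> * \<epsilon>) < - c * (2 * \<epsilon>\<^sup>2)"
  shows "(1 + exp (- \<beta> * \<epsilon>)) * (ball_max (closure \<Omega>) u \<epsilon> x - u x)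
    \<le> ball_max (closure \<Omega>) u (2 * \<epsilon>) x - u x + C * (\<epsilon> * cone1 \<beta> \<epsilon>)"
proof -
  interpret usc_compact "closure \<Omega>" u by (rule usc_compact[OF sub])
  define m1 where "m1 = ball_max (closure \<Omega>) u \<epsilon> x - u x"
  define m2 where "m2 = ball_max (closure \<Omega>) u (2 * \<epsilon>) x - u x"
  define a where "a = (m2 + C * cone2 \<beta> (2 * \<epsilon>)) / cone1 \<beta> (2 * \<epsilon>)"
  have E: "0 < cone1 \<beta> \<epsilon>" "0 < cone1 \<beta> (2 * \<epsilon>)" using \<open>0 < \<epsilon>\<close> by (auto simp: cone1_pos)
  have a0: "0 \<le> a"
    using cone_slope_nonneg[OF sub x K \<open>0 < \<epsilon>\<close> h small] E by (simp add: a_def m2_def)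
  have ga: "cone_profile \<beta> a C (2 * \<epsilon>) = m2" using E by (simp add: cone_profile_def a_def)
  have m12: "m1 \<le> m2"
    unfolding m1_def m2_def using ball_max_le_double[OF x x, of \<epsilon>] \<open>0 < \<epsilon>\<close> by simp
  have "m1 \<le> cone_profile \<beta> a C \<epsilon>"
  proof (rule ccontr)
    assume n: "\<not> ?thesis"
    \<comment> \<open>The slope is raised so that the value at \<epsilon> covers half of the
      supposed gap: still below \<open>m1\<close>, but now strictly above \<open>m2\<close> at 2
      \<epsilon>.\<close>
    define b where "b = a + (m1 - cone_profile \<beta> a C \<epsilon>) / (2 * cone1 \<beta> \<epsilon>)"
    have ab: "a < b" using n E by (simp add: b_def)
    then have b: "0 < b" using a0 by simp
    have "cone_profile \<beta> b C \<epsilon> = cone_profile \<beta> a C \<epsilon> + (m1 - cone_profile \<beta> a C \<epsilon>) / 2"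
      using E by (simp add: cone_profile_def b_def field_simps)
    then have gb1: "cone_profile \<beta> b C \<epsilon> < m1" using n by (simp add: field_simps)
    have gb2: "m2 < cone_profile \<beta> b C (2 * \<epsilon>)"
      unfolding ga[symmetric] cone_profile_def using ab E by simp
    \<comment> \<open>The profile may stop increasing before 2 \<epsilon>. Cutting at a maximum
      point keeps its slope positive on the whole ball used for comparison, by
      \<open>cone_profile_deriv_neg\<close>, and its value there is still above
      \<open>m2\<close>.\<close>
    obtain \<rho> where \<rho>: "\<epsilon> \<le> \<rho>" "\<rho> \<le> 2 * \<epsilon>"
      and \<rho>_max: "\<And>r. \<epsilon> \<le> r \<Longrightarrow> r \<le> 2 * \<epsilon> \<Longrightarrow> cone_profile \<beta> b C r \<le> cone_profile \<beta> b C \<rho>"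
      using continuous_attains_sup[of "{\<epsilon>..2*\<epsilon>}" "cone_profile \<beta> b C"] continuous_on_cone_profile \<open>0 < \<epsilon>\<close> by auto
    have g\<rho>: "m2 < cone_profile \<beta> b C \<rho>" using gb2 \<rho>_max[of "2 * \<epsilon>"] \<open>0 < \<epsilon>\<close> by simp
    then have "\<rho> \<noteq> \<epsilon>" using gb1 m12 by auto
    then have lt: "\<epsilon> < \<rho>" using \<rho> by simp
    have pos: "0 < cone_profile_deriv \<beta> b C r" if r: "0 \<le> r" "r < \<rho>" for r
    proof (rule ccontr)
      assume "\<not> ?thesis"
      then have neg: "cone_profile_deriv \<beta> b C t < 0" if "r < t" for t
        using cone_profile_deriv_neg[OF b r(1) that] by simp
      have "cone_profile \<beta> b C (max r \<epsilon>) > cone_profile \<beta> b C \<rho>"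
        using lt r by (intro DERIV_neg_imp_decreasing_open[where f="cone_profile \<beta> b C"])
          (auto intro!: has_derivative_cone_profile neg continuous_on_cone_profile exI)
      then show False using \<rho>_max[of "max r \<epsilon>"] r lt \<rho> by auto
    qed
    obtain z where z: "z \<in> closure \<Omega>" "dist x z \<le> \<epsilon>" "ball_max (closure \<Omega>) u \<epsilon> x = u z"
      using ball_max_attained[OF x, of \<epsilon>] \<open>0 < \<epsilon>\<close> by auto
    have "u z \<le> u x + cone_profile \<beta> b C (dist x z)"
    proof (rule cone_comparison[OF sub x _ _ \<open>c < C\<close> _ pos _ z(1)])
      show "closure \<Omega> \<inter> cball x \<rho> \<subseteq> \<Omega> \<union> \<Gamma>" using K \<rho> by auto
      fix y assume y: "y \<in> closure \<Omega>" "dist x y = \<rho>"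
      then have "u y \<le> ball_max (closure \<Omega>) u (2 * \<epsilon>) x" using x \<rho> by (intro ball_max_upper) auto
      then show "u y \<le> u x + cone_profile \<beta> b C \<rho>" using g\<rho> by (simp add: m2_def)
    qed (use h \<rho> z lt \<open>0 < \<epsilon>\<close> in auto)
    also have "cone_profile \<beta> b C (dist x z) \<le> cone_profile \<beta> b C \<epsilon>"
    proof (cases "dist x z = \<epsilon>")
      case False
      then show ?thesis
        using z lt cone_profile_less[of "dist x z" \<epsilon> \<beta> b C] pos order_trans[OF zero_le_dist less_imp_le]
        by (smt (verit) zero_le_dist)
    qed simp
    finally show False using gb1 z by (simp add: m1_def)
  qed
  then have "(1 + exp (- \<beta> * \<epsilon>)) * m1 \<le> (1 + exp (- \<beta> * \<epsilon>)) * cone_profile \<beta> a C \<epsilon>"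
    by (intro mult_left_mono) (auto simp: add_nonneg_nonneg)
  also have "\<dots> = cone_profile \<beta> a C (2 * \<epsilon>) + C * (\<epsilon> * cone1 \<beta> \<epsilon>)"
    unfolding cone_profile_def cone1_double cone2_double by (simp add: algebra_simps)
  finally show ?thesis unfolding ga by (simp add: m1_def m2_def)
qed

end

section \<open>The comparison principle\<close>

text \<open>Negating the test function exchanges the two infinity Laplacians and reverses the
  boundary inequality, but leaves the norm of the gradient unchanged; hence the sign of \<beta>
  flips.\<close>

lemma viscosity_supersolution_uminus:
  assumes "viscosity_supersolution \<Omega> \<Gamma> \<nu> \<beta> h v"
  shows "viscosity_subsolution \<Omega> \<Gamma> \<nu> (- \<beta>) (\<lambda>x. - h x) (\<lambda>x. - v x)"
  unfolding viscosity_subsolution_def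
proof (intro conjI allI impI)
  show "usc_on (closure \<Omega>) (\<lambda>x. - v x)"
    unfolding usc_on_def
  proof (intro ballI allI impI)
    fix x and e :: real assume "x \<in> closure \<Omega>" "0 < e"
    then obtain d where "d > 0" "\<forall>y\<in>closure \<Omega>. dist y x < d \<longrightarrow> v x - e < v y"
      using assms unfolding viscosity_supersolution_def lsc_on_def by blast
    then show "\<exists>d>0. \<forall>y\<in>closure \<Omega>. dist y x < d \<longrightarrow> - v y < - v x + e"
      by (intro exI[of _ d]) (auto simp: algebra_simps)
  qed
next
  fix \<phi> G H x0
  assume C2: "C2_closure \<Omega> \<phi> G H" and x0: "x0 \<in> \<Omega> \<union> \<Gamma>"
    and max: "local_max_rel (closure \<Omega>) (\<lambda>y. - v y - \<phi> y) x0"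
  have "C2_closure \<Omega> (\<lambda>y. - \<phi> y) (\<lambda>y. - G y) (\<lambda>y. - H y)"
    using C2 unfolding C2_closure_def
    by (auto intro!: continuous_intros derivative_eq_intros
        intro: has_derivative_eq_rhs[OF has_derivative_minus] simp: fun_eq_iff uminus_blinfun.rep_eq)
  moreover have "local_min_rel (closure \<Omega>) (\<lambda>y. v y - - \<phi> y) x0"
    using max unfolding local_max_rel_def local_min_rel_def by (force simp: algebra_simps)
  ultimately have "- inf_lap_minus (- G x0) (- H x0) - \<beta> * norm (- G x0) \<ge> h x0 \<or>
         (x0 \<in> \<Gamma> \<and> - G x0 \<bullet> \<nu> x0 \<ge> 0)"
    using assms x0 unfolding viscosity_supersolution_def by blast
  then show "- inf_lap_plus (G x0) (H x0) - - \<beta> * norm (G x0) \<le> - h x0 \<or>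
         (x0 \<in> \<Gamma> \<and> G x0 \<bullet> \<nu> x0 \<le> 0)"
    by (auto simp: inf_lap_minus_def)
qed

text \<open>Since \<open>cone2 \<beta> (2 * \<epsilon>)\<close> behaves like 2 \<epsilon>^2,
  dividing both sides by 2 \<epsilon>^2 leaves - C < - c in the limit. This supplies the smallness
  hypothesis of \<open>discrete_subsolution\<close>.\<close>

lemma small_radius:
  assumes "c < C"
  obtains d where "0 < d" "\<And>\<epsilon>. 0 < \<epsilon> \<Longrightarrow> \<epsilon> < d \<Longrightarrow> C < 0 \<Longrightarrow>
    - C * cone2 \<beta> (2 * \<epsilon>) * (1 + 2 * \<bar>\<beta>\<bar> * \<epsilon>) < - c * (2 * \<epsilon>\<^sup>2)"
proof -
  have "((\<lambda>\<epsilon>. - C * (cone2 \<beta> (2 * \<epsilon>) / (2 * \<epsilon>\<^sup>2)) * (1 + 2 * \<bar>\<beta>\<bar> * \<epsilon>)) \<longlongrightarrow> - C * 1 * (1 + 2 * \<bar>\<beta>\<bar> * 0)) (at_right 0)"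
    by (intro tendsto_intros cone2_asymp)
  then have "\<forall>\<^sub>F \<epsilon> in at_right 0. - C * (cone2 \<beta> (2 * \<epsilon>) / (2 * \<epsilon>\<^sup>2)) * (1 + 2 * \<bar>\<beta>\<bar> * \<epsilon>) < - c"
    by (rule order_tendstoD) (use assms in simp)
  then obtain d where d: "d > 0"
    "\<And>\<epsilon>. 0 < \<epsilon> \<Longrightarrow> \<epsilon> < d \<Longrightarrow> - C * (cone2 \<beta> (2 * \<epsilon>) / (2 * \<epsilon>\<^sup>2)) * (1 + 2 * \<bar>\<beta>\<bar> * \<epsilon>) < - c"
    by (auto simp: eventually_at_right_field)
  show ?thesis
  proof (rule that[OF d(1)])
    fix \<epsilon> :: real assume \<epsilon>: "0 < \<epsilon>" "\<epsilon> < d"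
    then have "- C * (cone2 \<beta> (2 * \<epsilon>) / (2 * \<epsilon>\<^sup>2)) * (1 + 2 * \<bar>\<beta>\<bar> * \<epsilon>) * (2 * \<epsilon>\<^sup>2) < - c * (2 * \<epsilon>\<^sup>2)"
      by (intro mult_strict_right_mono d) auto
    moreover have "- C * (cone2 \<beta> (2 * \<epsilon>) / (2 * \<epsilon>\<^sup>2)) * (1 + 2 * \<bar>\<beta>\<bar> * \<epsilon>) * (2 * \<epsilon>\<^sup>2)
        = - C * cone2 \<beta> (2 * \<epsilon>) * (1 + 2 * \<bar>\<beta>\<bar> * \<epsilon>)"
      using \<epsilon> by (simp add: divide_simps)
    ultimately show "- C * cone2 \<beta> (2 * \<epsilon>) * (1 + 2 * \<bar>\<beta>\<bar> * \<epsilon>) < - c * (2 * \<epsilon>\<^sup>2)" by simp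
  qed
qed

lemma (in usc_compact) usc_compact_cmult:
  assumes "0 < l"
  shows "usc_compact X (\<lambda>x. l * f x)"
proof
  show "usc_on X (\<lambda>x. l * f x)"
    unfolding usc_on_def
  proof (intro ballI allI impI)
    fix x and e :: real assume "x \<in> X" "0 < e"
    then obtain d where d: "d > 0" "\<forall>y\<in>X. dist y x < d \<longrightarrow> f y < f x + e / l"
      using usc_onD[OF usc, of x "e / l"] assms by auto
    then show "\<exists>d>0. \<forall>y\<in>X. dist y x < d \<longrightarrow> l * f y < l * f x + e"
      using assms by (intro exI[of _ d]) (auto simp: field_simps)
  qed
qed (rule compact)

lemma (in usc_compact) ball_max_cmult:
  assumes "0 < l" "x \<in> X" "0 \<le> r"
  shows "ball_max X (\<lambda>x. l * f x) r x = l * ball_max X f r x"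
proof -
  interpret l: usc_compact X "\<lambda>x. l * f x" by (rule usc_compact_cmult[OF assms(1)])
  obtain y where y: "y \<in> X" "dist x y \<le> r" "ball_max X f r x = f y"
    using ball_max_attained assms by metis
  obtain z where z: "z \<in> X" "dist x z \<le> r" "ball_max X (\<lambda>x. l * f x) r x = l * f z"
    using l.ball_max_attained assms by metis
  have "f z \<le> f y" using ball_max_upper[of z x r] y z assms by simp
  then have "l * f z \<le> l * f y" using assms by simp
  moreover have "l * f y \<le> l * f z" using l.ball_max_upper[of y x r] y z assms by simp
  ultimately show ?thesis using y z by simp
qed

section \<open>The discrete inequalities for the pair u, w\<close>

locale mixed_problem = mixed_domain \<Omega> \<Gamma> \<nu>
  for \<Omega> \<Gamma> :: "'a::euclidean_space set" and \<nu> +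
  fixes D :: "'a set" and \<beta> :: real and h h' u w :: "'a \<Rightarrow> real"
  assumes D: "closed D" "D \<noteq> {}" "D \<subseteq> closure \<Omega>" "\<Gamma> = frontier \<Omega> - D" "D \<inter> \<Omega> = {}"
    and sub_u: "viscosity_subsolution \<Omega> \<Gamma> \<nu> \<beta> h u"
    and sub_w: "viscosity_subsolution \<Omega> \<Gamma> \<nu> (- \<beta>) (\<lambda>x. - h' x) w"
begin

sublocale u: usc_compact "closure \<Omega>" u by (rule usc_compact[OF sub_u])
sublocale w: usc_compact "closure \<Omega>" w by (rule usc_compact[OF sub_w])

lemma mem_cases: "x \<in> closure \<Omega> \<Longrightarrow> x \<notin> D \<Longrightarrow> x \<in> \<Omega> \<union> \<Gamma>"
  using D open_\<Omega> by (auto simp: frontier_def interior_open)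

lemma cball_mem_cases:
  assumes "cball x r \<inter> D = {}" "y \<in> closure \<Omega>" "dist x y \<le> r"
  shows "y \<in> \<Omega> \<union> \<Gamma>"
proof (rule mem_cases[OF assms(2)])
  have "y \<in> cball x r" using assms(3) by simp
  with assms(1) show "y \<notin> D" by blast
qed

lemma ball_disjoint:
  assumes "x \<notin> D"
  obtains d where "0 < d" "ball x d \<inter> D = {}"
proof -
  have "open (- D)" using D(1) by (rule open_Compl)
  then obtain d where "0 < d" "ball x d \<subseteq> - D"
    using assms open_contains_ball[of "- D"] by blast
  then show ?thesis by (intro that[of d]) auto
qed

text \<open>With a Neumann part the domain is convex. Without one, \<open>D\<close> contains the
  whole frontier, so a ball avoiding \<open>D\<close> and centred in the closure is connected,
  misses the frontier and lies inside the domain.\<close>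

lemma convex_closure_Int_cball:
  assumes "x \<in> closure \<Omega>" "cball x r \<inter> D = {}"
  shows "convex (closure \<Omega> \<inter> cball x r)"
proof (cases "\<Gamma> = {}")
  case False
  then show ?thesis by (intro convex_Int convex_closure convex convex_cball)
next
  case True
  show ?thesis
  proof (cases "cball x r = {}")
    case False
    then have "x \<in> cball x r" by simp
    have "frontier \<Omega> \<subseteq> D" using D(4) True by auto
    then have "cball x r \<inter> frontier \<Omega> = {}" using assms by auto
    moreover have "x \<in> \<Omega>"
      using cball_mem_cases[OF assms(2,1)] \<open>x \<in> cball x r\<close> True by simp
    ultimately have "cball x r \<subseteq> \<Omega>"
      using connected_Int_frontier[OF connected_cball, of x r \<Omega>] \<open>x \<in> cball x r\<close> by blast
    then have "closure \<Omega> \<inter> cball x r = cball x r" using closure_subset by blast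
    then show ?thesis by simp
  qed simp
qed

lemma discrete_u:
  assumes "x \<in> closure \<Omega>" "cball x (2 * \<epsilon>) \<inter> D = {}" "0 < \<epsilon>"
    and "\<And>y. y \<in> \<Omega> \<union> \<Gamma> \<Longrightarrow> dist x y \<le> 2 * \<epsilon> \<Longrightarrow> h y \<le> c" and "c < C"
    and "C < 0 \<Longrightarrow> - C * cone2 \<beta> (2 * \<epsilon>) * (1 + 2 * \<bar>\<beta>\<bar> * \<epsilon>) < - c * (2 * \<epsilon>\<^sup>2)"
  shows "(1 + exp (- \<beta> * \<epsilon>)) * (ball_max (closure \<Omega>) u \<epsilon> x - u x)
    \<le> ball_max (closure \<Omega>) u (2 * \<epsilon>) x - u x + C * (\<epsilon> * cone1 \<beta> \<epsilon>)"
proof (rule discrete_subsolution[OF sub_u assms(1) _ assms(3) _ assms(5,6)])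
  have m: "y \<in> \<Omega> \<union> \<Gamma>" if "y \<in> closure \<Omega>" "dist x y \<le> 2 * \<epsilon>" for y
    using cball_mem_cases[OF assms(2) that] .
  show "closure \<Omega> \<inter> cball x (2 * \<epsilon>) \<subseteq> \<Omega> \<union> \<Gamma>" by (intro subsetI m) auto
  show "h y \<le> c" if "y \<in> closure \<Omega>" "dist x y \<le> 2 * \<epsilon>" for y
    using assms(4) m that by blast
qed

text \<open>The inequality for - \<beta> is multiplied by exp (- \<beta> \<epsilon>), which makes
  its left-hand coefficient and error term match those of \<open>discrete_u\<close>.\<close>

lemma discrete_w:
  assumes "x \<in> closure \<Omega>" "cball x (2 * \<epsilon>) \<inter> D = {}" "0 < \<epsilon>"
    and "\<And>y. y \<in> \<Omega> \<union> \<Gamma> \<Longrightarrow> dist x y \<le> 2 * \<epsilon> \<Longrightarrow> c \<le> h' y" and "C < c"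
    and "0 < C \<Longrightarrow> C * cone2 (- \<beta>) (2 * \<epsilon>) * (1 + 2 * \<bar>\<beta>\<bar> * \<epsilon>) < c * (2 * \<epsilon>\<^sup>2)"
  shows "(1 + exp (- \<beta> * \<epsilon>)) * (ball_max (closure \<Omega>) w \<epsilon> x - w x)
    \<le> exp (- \<beta> * \<epsilon>) * (ball_max (closure \<Omega>) w (2 * \<epsilon>) x - w x) - C * (\<epsilon> * cone1 \<beta> \<epsilon>)"
proof -
  have m: "y \<in> \<Omega> \<union> \<Gamma>" if "y \<in> closure \<Omega>" "dist x y \<le> 2 * \<epsilon>" for y
    using cball_mem_cases[OF assms(2) that] .
  have "(1 + exp (- (- \<beta>) * \<epsilon>)) * (ball_max (closure \<Omega>) w \<epsilon> x - w x)
    \<le> ball_max (closure \<Omega>) w (2 * \<epsilon>) x - w x + - C * (\<epsilon> * cone1 (- \<beta>) \<epsilon>)"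
  proof (rule discrete_subsolution[OF sub_w assms(1) _ assms(3), where c="- c"])
    show "closure \<Omega> \<inter> cball x (2 * \<epsilon>) \<subseteq> \<Omega> \<union> \<Gamma>" by (intro subsetI m) auto
    show "- h' y \<le> - c" if "y \<in> closure \<Omega>" "dist x y \<le> 2 * \<epsilon>" for y
      using assms(4) m that by simp
  qed (use assms(5,6) in auto)
  then have "exp (- \<beta> * \<epsilon>) * ((1 + exp (\<beta> * \<epsilon>)) * (ball_max (closure \<Omega>) w \<epsilon> x - w x))
    \<le> exp (- \<beta> * \<epsilon>) * (ball_max (closure \<Omega>) w (2 * \<epsilon>) x - w x + - C * (\<epsilon> * cone1 (- \<beta>) \<epsilon>))"
    by (intro mult_left_mono) auto
  also have "exp (- \<beta> * \<epsilon>) * ((1 + exp (\<beta> * \<epsilon>)) * (ball_max (closure \<Omega>) w \<epsilon> x - w x))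
      = (exp (- \<beta> * \<epsilon>) + exp (- \<beta> * \<epsilon>) * exp (\<beta> * \<epsilon>)) * (ball_max (closure \<Omega>) w \<epsilon> x - w x)"
    by (simp only: distrib_left distrib_right mult_1_right mult.assoc)
  also have "exp (- \<beta> * \<epsilon>) * (ball_max (closure \<Omega>) w (2 * \<epsilon>) x - w x + - C * (\<epsilon> * cone1 (- \<beta>) \<epsilon>))
      = exp (- \<beta> * \<epsilon>) * (ball_max (closure \<Omega>) w (2 * \<epsilon>) x - w x)
        - C * (\<epsilon> * ((exp (- \<beta> * \<epsilon>) * exp (\<beta> * \<epsilon>)) * cone1 \<beta> \<epsilon>))"
    by (simp only: cone1_uminus) (simp only: distrib_left mult_minus_left mult_minus_right diff_conv_add_uminus mult_ac)
  also have "exp (- \<beta> * \<epsilon>) * exp (\<beta> * \<epsilon>) = 1" by (simp flip: exp_add)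
  finally show ?thesis by (simp only: add.commute mult_1_left)
qed

text \<open>Any positive C is admissible above the bound 0, and for such C the smallness condition
  is vacuous. Taking C = e / k makes the error equal to an arbitrary e > 0.\<close>

lemma discrete_u_zero:
  assumes "x \<in> closure \<Omega>" "cball x (2 * \<epsilon>) \<inter> D = {}" "0 < \<epsilon>"
    and "\<And>y. y \<in> \<Omega> \<union> \<Gamma> \<Longrightarrow> h y \<le> 0"
  shows "(1 + exp (- \<beta> * \<epsilon>)) * (ball_max (closure \<Omega>) u \<epsilon> x - u x)
    \<le> ball_max (closure \<Omega>) u (2 * \<epsilon>) x - u x"
proof (rule field_le_epsilon)
  fix e :: real assume "0 < e"
  define k where "k = \<epsilon> * cone1 \<beta> \<epsilon>"
  have k: "0 < k" using assms(3) by (simp add: k_def cone1_pos)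
  have ek: "0 < e / k" using \<open>0 < e\<close> k by simp
  have "(1 + exp (- \<beta> * \<epsilon>)) * (ball_max (closure \<Omega>) u \<epsilon> x - u x)
    \<le> ball_max (closure \<Omega>) u (2 * \<epsilon>) x - u x + e / k * k"
    unfolding k_def
  proof (rule discrete_u[OF assms(1-3), where c=0], fold k_def)
    show "0 < e / k" by (rule ek)
    show "- (e / k) * cone2 \<beta> (2 * \<epsilon>) * (1 + 2 * \<bar>\<beta>\<bar> * \<epsilon>) < - 0 * (2 * \<epsilon>\<^sup>2)"
      if "e / k < 0" using ek that by linarith
  qed (use assms(4) in auto)
  also have "e / k * k = e" using k by simp
  finally show "(1 + exp (- \<beta> * \<epsilon>)) * (ball_max (closure \<Omega>) u \<epsilon> x - u x)
    \<le> ball_max (closure \<Omega>) u (2 * \<epsilon>) x - u x + e" .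
qed

lemma discrete_w_zero:
  assumes "x \<in> closure \<Omega>" "cball x (2 * \<epsilon>) \<inter> D = {}" "0 < \<epsilon>"
    and "\<And>y. y \<in> \<Omega> \<union> \<Gamma> \<Longrightarrow> 0 \<le> h' y"
  shows "(1 + exp (- \<beta> * \<epsilon>)) * (ball_max (closure \<Omega>) w \<epsilon> x - w x)
    \<le> exp (- \<beta> * \<epsilon>) * (ball_max (closure \<Omega>) w (2 * \<epsilon>) x - w x)"
proof (rule field_le_epsilon)
  fix e :: real assume "0 < e"
  define k where "k = \<epsilon> * cone1 \<beta> \<epsilon>"
  have k: "0 < k" using assms(3) by (simp add: k_def cone1_pos)
  have ek: "- (e / k) < 0" using \<open>0 < e\<close> k by simp
  have "(1 + exp (- \<beta> * \<epsilon>)) * (ball_max (closure \<Omega>) w \<epsilon> x - w x)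
    \<le> exp (- \<beta> * \<epsilon>) * (ball_max (closure \<Omega>) w (2 * \<epsilon>) x - w x) - - (e / k) * k"
    unfolding k_def
  proof (rule discrete_w[OF assms(1-3), where c=0], fold k_def)
    show "- (e / k) < 0" by (rule ek)
    show "- (e / k) * cone2 (- \<beta>) (2 * \<epsilon>) * (1 + 2 * \<bar>\<beta>\<bar> * \<epsilon>) < 0 * (2 * \<epsilon>\<^sup>2)"
      if "0 < - (e / k)" using ek that by linarith
  qed (use assms(4) in auto)
  also have "- (e / k) * k = - e" using k by simp
  finally show "(1 + exp (- \<beta> * \<epsilon>)) * (ball_max (closure \<Omega>) w \<epsilon> x - w x)
    \<le> exp (- \<beta> * \<epsilon>) * (ball_max (closure \<Omega>) w (2 * \<epsilon>) x - w x) + e" by simp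
qed

text \<open>If the level at \<open>x\<close> exceeded all values on \<open>D\<close>, maximum points
  of the ball-maximum sums would accumulate at a point off \<open>D\<close>, where the strict gap
  between the right-hand sides persists nearby. The factor \<open>l\<close> allows a rescaled
  supersolution.\<close>

lemma comparison_strict:
  assumes h: "usc_on (\<Omega> \<union> \<Gamma>) h" and h': "lsc_on (\<Omega> \<union> \<Gamma>) h'"
    and l: "0 < l" and less: "\<And>x. x \<in> \<Omega> \<union> \<Gamma> \<Longrightarrow> h x < l * h' x" and x: "x \<in> closure \<Omega>"
  shows "\<exists>d\<in>D. u x + l * w x \<le> u d + l * w d"
proof (rule ccontr)
  assume "\<not> ?thesis"
  then have lt: "u d + l * w d < u x + l * w x" if "d \<in> D" for d using that by (auto simp: not_le)
  define X where "X = closure \<Omega>"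
  have xX: "x \<in> X" using x by (simp add: X_def)
  define w' where "w' x = l * w x" for x
  interpret u: usc_compact X u unfolding X_def by (rule u.usc_compact_axioms)
  interpret w': usc_compact X w' unfolding X_def w'_def[abs_def] by (rule w.usc_compact_cmult[OF l])
  let ?f = "\<lambda>e y. ball_max X u e y + ball_max X w' e y"
  obtain x0 where x0: "x0 \<in> X" "u x + w' x \<le> u x0 + w' x0"
    "\<And>d. 0 < d \<Longrightarrow> \<exists>e y. 0 < e \<and> e < d \<and> y \<in> X \<and> dist y x0 < d \<and> (\<forall>z\<in>X. ?f e z \<le> ?f e y)"
  proof (rule ball_max_limit[OF u.usc_compact_axioms w'.usc_compact_axioms,
        where M="u x + w' x" and P="\<lambda>e y. \<forall>z\<in>X. ?f e z \<le> ?f e y"])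
    fix d :: real assume d: "0 < d"
    have usc: "usc_on X (?f (d / 2))"
      using d by (intro usc_on_add u.usc_on_ball_max w'.usc_on_ball_max) auto
    obtain y where y: "y \<in> X" "\<And>z. z \<in> X \<Longrightarrow> ?f (d / 2) z \<le> ?f (d / 2) y"
      using usc_on_attains_sup[OF u.compact _ usc] xX by blast
    have "u x + w' x \<le> ?f (d / 2) x"
      using d by (intro add_mono u.ball_max_ge w'.ball_max_ge xX) auto
    also have "\<dots> \<le> ?f (d / 2) y" by (rule y(2)[OF xX])
    finally show "\<exists>e y. 0 < e \<and> e < d \<and> y \<in> X \<and> u x + w' x \<le> ?f e y \<and> (\<forall>z\<in>X. ?f e z \<le> ?f e y)"
      using d y by (intro exI[of _ "d / 2"] exI[of _ y]) auto
  qed (rule that)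
  have "x0 \<notin> D" using lt[of x0] x0(2) by (auto simp: w'_def)
  then have x0': "x0 \<in> \<Omega> \<union> \<Gamma>" using mem_cases x0(1) by (simp add: X_def)
  \<comment> \<open>The constants \<open>c1\<close> and \<open>c2\<close> bound the right-hand sides
    near \<open>x0\<close>; the constants \<open>C1\<close> and \<open>C2\<close> of the cones leave
    room on both sides and keep \<open>C1 < C2\<close>.\<close>
  obtain C1 C2 where C: "h x0 < C1" "C1 < C2" "C2 < l * h' x0"
    using less[OF x0'] by (meson dense)
  obtain c1 where c1: "h x0 < c1" "c1 < C1" using C dense by blast
  obtain c2 where c2: "C2 / l < c2" "c2 < h' x0"
    using dense[of "C2 / l" "h' x0"] C l by (auto simp: field_simps)
  obtain d1 where d1: "d1 > 0" "\<And>y. y \<in> \<Omega> \<union> \<Gamma> \<Longrightarrow> dist y x0 < d1 \<Longrightarrow> h y < c1"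
    using usc_onD[OF h x0', of "c1 - h x0"] c1 by auto
  obtain d2 where d2: "d2 > 0" "\<And>y. y \<in> \<Omega> \<union> \<Gamma> \<Longrightarrow> dist y x0 < d2 \<Longrightarrow> c2 < h' y"
    using h'[unfolded lsc_on_def, rule_format, OF x0', of "h' x0 - c2"] c2 by auto
  obtain d3 where d3: "d3 > 0" "ball x0 d3 \<inter> D = {}"
    using \<open>x0 \<notin> D\<close> by (rule ball_disjoint)
  obtain d4 where d4: "0 < d4" "\<And>\<epsilon>. 0 < \<epsilon> \<Longrightarrow> \<epsilon> < d4 \<Longrightarrow> C1 < 0 \<Longrightarrow>
    - C1 * cone2 \<beta> (2 * \<epsilon>) * (1 + 2 * \<bar>\<beta>\<bar> * \<epsilon>) < - c1 * (2 * \<epsilon>\<^sup>2)"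
    using small_radius[OF c1(2)] by metis
  obtain d5 where d5: "0 < d5" "\<And>\<epsilon>. 0 < \<epsilon> \<Longrightarrow> \<epsilon> < d5 \<Longrightarrow> - (C2 / l) < 0 \<Longrightarrow>
    - (- (C2 / l)) * cone2 (- \<beta>) (2 * \<epsilon>) * (1 + 2 * \<bar>- \<beta>\<bar> * \<epsilon>) < - (- c2) * (2 * \<epsilon>\<^sup>2)"
    using small_radius[of "- c2" "- (C2 / l)" "- \<beta>"] c2 by (metis neg_less_iff_less)
  \<comment> \<open>A third, because points within 2 e of \<open>y\<close> are within 3 d of
    \<open>x0\<close>.\<close>
  define d where "d = min (min d1 d2) (min d3 (min d4 d5)) / 3"
  have d: "0 < d" "3 * d \<le> d1" "3 * d \<le> d2" "3 * d \<le> d3" "d < d4" "d < d5"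
    using d1 d2 d3 d4 d5 by (auto simp: d_def)
  obtain e y where e: "0 < e" "e < d" and y: "y \<in> X" "dist y x0 < d"
    and max: "\<And>z. z \<in> X \<Longrightarrow> ?f e z \<le> ?f e y"
    using x0(3)[OF d(1)] by blast
  have near: "dist z x0 < 3 * d" if "dist y z \<le> 2 * e" for z
    using dist_triangle[of z x0 y] that e y by (simp add: dist_commute)
  have disj: "cball y (2 * e) \<inter> D = {}"
    using near d d3 by (force simp: dist_commute)
  define k where "k = e * cone1 \<beta> e"
  have k: "0 < k" using e by (simp add: k_def cone1_pos)
  define q where "q = exp (- \<beta> * e)"
  have 1: "(1 + q) * (ball_max X u e y - u y) \<le> ball_max X u (2 * e) y - u y + C1 * k"
    unfolding X_def q_def k_def
  proof (rule discrete_u[OF _ disj e(1) _ c1(2)])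
    show "y \<in> closure \<Omega>" using y by (simp add: X_def)
    show "h z \<le> c1" if "z \<in> \<Omega> \<union> \<Gamma>" "dist y z \<le> 2 * e" for z
      using d1(2)[OF that(1)] near[OF that(2)] d by simp
    show "- C1 * cone2 \<beta> (2 * e) * (1 + 2 * \<bar>\<beta>\<bar> * e) < - c1 * (2 * e\<^sup>2)" if "C1 < 0"
      using d4(2)[of e] that e d by simp
  qed
  have 2: "(1 + q) * (ball_max X w e y - w y) \<le> q * (ball_max X w (2 * e) y - w y) - C2 / l * k"
    unfolding X_def q_def k_def
  proof (rule discrete_w[OF _ disj e(1) _ c2(1)])
    show "y \<in> closure \<Omega>" using y by (simp add: X_def)
    show "c2 \<le> h' z" if "z \<in> \<Omega> \<union> \<Gamma>" "dist y z \<le> 2 * e" for z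
      using d2(2)[OF that(1)] near[OF that(2)] d by simp
    show "C2 / l * cone2 (- \<beta>) (2 * e) * (1 + 2 * \<bar>\<beta>\<bar> * e) < c2 * (2 * e\<^sup>2)" if "0 < C2 / l"
      using d5(2)[of e] that e d by simp
  qed
  have W: "ball_max X w' r y = l * ball_max X w r y" if "0 \<le> r" for r
    unfolding w'_def[abs_def] X_def using w.ball_max_cmult[OF l, of y r] y that by (simp add: X_def)
  have "l * ((1 + q) * (ball_max X w e y - w y)) \<le> l * (q * (ball_max X w (2 * e) y - w y) - C2 / l * k)"
    using 2 l by (intro mult_left_mono) auto
  then have 2: "(1 + q) * (ball_max X w' e y - w' y) \<le> q * (ball_max X w' (2 * e) y - w' y) - C2 * k"
    using e l by (simp add: W w'_def algebra_simps)
  have cv: "convex (X \<inter> cball y (2 * e))"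
    unfolding X_def using y disj by (intro convex_closure_Int_cball) (auto simp: X_def)
  have 3: "ball_max X u (2 * e) y - ball_max X u e y \<le> ball_max X w' e y - w' y"
    using e max by (intro discrete_step[OF u.usc_compact_axioms w'.usc_compact_axioms y(1) _ cv]) auto
  have "ball_max X w' (2 * e) y - ball_max X w' e y \<le> ball_max X u e y - u y"
    using e max by (intro discrete_step[OF w'.usc_compact_axioms u.usc_compact_axioms y(1) _ cv])
      (auto simp: add.commute)
  then have "q * (ball_max X w' (2 * e) y - ball_max X w' e y) \<le> q * (ball_max X u e y - u y)"
    by (intro mult_left_mono) (auto simp: q_def)
  \<comment> \<open>Write U, W for the maxima at radius e and U2, W2 for those at 2 e, with W and W2
    formed from \<open>w'\<close>. Then W - w' \<le> q (W2 - W) - C2 k \<le> q (U - u) - C2 k \<le>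
    U2 - U + (C1 - C2) k \<le> W - w' + (C1 - C2) k.\<close>
  with 1 2 3 have "C2 * k \<le> C1 * k" by (simp add: algebra_simps)
  then show False using C k by simp
qed

text \<open>Inside the set where the discretised difference is maximal, the points maximising the
  discretised subsolution form a subset that contains the \<open>e\<close>-ball about each of its
  points, hence by connectedness everything.\<close>

lemma comparison_zero:
  assumes conn: "connected \<Omega>" and h: "\<And>x. x \<in> \<Omega> \<union> \<Gamma> \<Longrightarrow> h x \<le> 0"
    and h': "\<And>x. x \<in> \<Omega> \<union> \<Gamma> \<Longrightarrow> 0 \<le> h' x" and x: "x \<in> closure \<Omega>"
  shows "\<exists>d\<in>D. u x + w x \<le> u d + w d"
proof (rule ccontr)
  assume "\<not> ?thesis"
  then have lt: "u d + w d < u x + w x" if "d \<in> D" for d using that by (auto simp: not_le)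
  define X where "X = closure \<Omega>"
  have xX: "x \<in> X" using x by (simp add: X_def)
  interpret u: usc_compact X u unfolding X_def by (rule u.usc_compact_axioms)
  interpret w: usc_compact X w unfolding X_def by (rule w.usc_compact_axioms)
  let ?f = "\<lambda>e y. ball_max X u e y + ball_max X w e y"
  \<comment> \<open>One radius works for all points at or above the level of \<open>x\<close>:
    otherwise the limit point of \<open>ball_max_limit\<close> would lie on \<open>D\<close> and
    reach that level.\<close>
  have "\<exists>e>0. \<forall>y\<in>X. u x + w x \<le> ?f e y \<longrightarrow> cball y (2 * e) \<inter> D = {}"
  proof (rule ccontr)
    assume n: "\<not> ?thesis"
    obtain x0 where x0: "x0 \<in> X" "u x + w x \<le> u x0 + w x0"
      "\<And>d. 0 < d \<Longrightarrow> \<exists>e y. 0 < e \<and> e < d \<and> y \<in> X \<and> dist y x0 < d \<and> cball y (2 * e) \<inter> D \<noteq> {}"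
    proof (rule ball_max_limit[OF u.usc_compact_axioms w.usc_compact_axioms,
        where M="u x + w x" and P="\<lambda>e y. cball y (2 * e) \<inter> D \<noteq> {}"])
      fix d :: real assume d: "0 < d"
      then obtain y where "y \<in> X" "u x + w x \<le> ?f (d / 2) y" "cball y (2 * (d / 2)) \<inter> D \<noteq> {}"
        using n half_gt_zero[OF d] by blast
      then show "\<exists>e y. 0 < e \<and> e < d \<and> y \<in> X \<and> u x + w x \<le> ?f e y \<and> cball y (2 * e) \<inter> D \<noteq> {}"
        using d by (intro exI[of _ "d / 2"] exI[of _ y]) auto
    qed (rule that)
    have "x0 \<notin> D" using lt[of x0] x0(2) by auto
    then obtain d where d: "d > 0" "ball x0 d \<inter> D = {}"
      by (rule ball_disjoint)
    then obtain e y p where "0 < e" "e < d / 3" "dist y x0 < d / 3" "p \<in> D" "dist y p \<le> 2 * e"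
      using x0(3)[of "d / 3"] by auto
    then have "p \<in> ball x0 d" using dist_triangle[of x0 p y] by (simp add: dist_commute)
    then show False using d(2) \<open>p \<in> D\<close> by blast
  qed
  then obtain e where e: "0 < e" "\<And>y. y \<in> X \<Longrightarrow> u x + w x \<le> ?f e y \<Longrightarrow> cball y (2 * e) \<inter> D = {}"
    by blast
  define U W where "U = ball_max X u e" and "W = ball_max X w e"
  have uscU: "usc_on X U" and uscf: "usc_on X (\<lambda>y. U y + W y)"
    unfolding U_def W_def using e by (auto intro!: usc_on_add u.usc_on_ball_max w.usc_on_ball_max)
  obtain xm where xm: "xm \<in> X" "\<And>y. y \<in> X \<Longrightarrow> U y + W y \<le> U xm + W xm"
    using usc_on_attains_sup[OF u.compact _ uscf] xX by blast
  define m where "m = U xm + W xm"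
  have "u x + w x \<le> U x + W x"
    unfolding U_def W_def using u.ball_max_ge[OF xX] w.ball_max_ge[OF xX] e by (simp add: add_mono)
  then have m: "u x + w x \<le> m" using xm(2)[OF xX] by (simp add: m_def)
  define E where "E = {y \<in> X. m \<le> U y + W y}"
  have clX: "closed X" by (simp add: X_def)
  have clE: "closed E" unfolding E_def by (rule closed_usc_on_superlevel[OF clX uscf])
  have "compact (X \<inter> E)" using u.compact clE by (rule compact_Int_closed)
  moreover have EX: "E \<subseteq> X" by (auto simp: E_def)
  ultimately have "compact E" by (simp add: Int_absorb1)
  moreover have "E \<noteq> {}" using xm by (auto simp: E_def m_def)
  \<comment> \<open>A second maximisation, of \<open>U\<close> within the maximum set of the sum;
    the resulting set \<open>F\<close> is what propagates.\<close>
  ultimately obtain x1 where x1: "x1 \<in> E" "\<And>y. y \<in> E \<Longrightarrow> U y \<le> U x1"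
    using usc_on_attains_sup[of E U] usc_on_subset[OF uscU EX] by blast
  define F where "F = {y \<in> E. U x1 \<le> U y}"
  have clF: "closed F"
    unfolding F_def by (rule closed_usc_on_superlevel[OF clE usc_on_subset[OF uscU EX]])
  have step: "z \<in> F" if y: "y \<in> F" and z: "z \<in> X" "dist y z \<le> e" for y z
  proof -
    have yE: "y \<in> E" and yX: "y \<in> X" using y by (auto simp: F_def E_def)
    have fy: "U y + W y = m" using yE xm(2)[OF yX] by (simp add: E_def m_def)
    have Uy: "U v \<le> U y" if "v \<in> E" for v using x1(2)[OF that] y by (simp add: F_def)
    have disj: "cball y (2 * e) \<inter> D = {}" using e(2)[OF yX] m fy by (simp add: U_def W_def)
    define U2 W2 where "U2 = ball_max X u (2 * e) y" and "W2 = ball_max X w (2 * e) y"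
    define q where "q = exp (- \<beta> * e)"
    have q: "0 < q" by (simp add: q_def)
    have cv: "convex (X \<inter> cball y (2 * e))"
      unfolding X_def using yX disj by (intro convex_closure_Int_cball) (auto simp: X_def)
    have max: "ball_max X u e z + ball_max X w e z \<le> ball_max X u e y + ball_max X w e y" if "z \<in> X" for z
      using xm(2)[OF that] fy by (simp add: U_def W_def m_def)
    have 1: "(1 + q) * (U y - u y) \<le> U2 - u y"
      using discrete_u_zero[of y e] yX disj e(1) h by (simp add: X_def U_def U2_def q_def)
    have 2: "(1 + q) * (W y - w y) \<le> q * (W2 - w y)"
      using discrete_w_zero[of y e] yX disj e(1) h' by (simp add: X_def W_def W2_def q_def)
    have 3: "U2 - U y \<le> W y - w y"
      unfolding U_def W_def U2_def
      using e(1) max by (intro discrete_step[OF u.usc_compact_axioms w.usc_compact_axioms yX _ cv]) auto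
    have "W2 - W y \<le> U y - u y"
      unfolding U_def W_def W2_def
      using e(1) max by (intro discrete_step[OF w.usc_compact_axioms u.usc_compact_axioms yX _ cv])
        (auto simp: add.commute)
    then have 4: "q * (W2 - W y) \<le> q * (U y - u y)" using q by simp
    have 5: "q * (U y - u y) \<le> U2 - U y" using 1 by (simp add: algebra_simps)
    have 6: "W y - w y \<le> q * (W2 - W y)" using 2 by (simp add: algebra_simps)
    \<comment> \<open>Facts 3 to 6 close into a cycle, so equality holds throughout; in particular
      U2 - U = W - w at \<open>y\<close>. Hence \<open>v\<close> also maximises the sum, and
      maximality of \<open>U\<close> on \<open>E\<close> yields U2 \<le> U y.\<close>
    obtain v where v: "v \<in> X" "dist y v \<le> e" "U2 \<le> U v"
      unfolding U_def U2_def using u.ball_max_double_attained[OF yX _ cv] e(1) by auto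
    have "w y \<le> W v"
      unfolding W_def using w.ball_max_upper[OF yX v(1)] v(2) by (simp add: dist_commute)
    then have "v \<in> E" using v fy 5 6 3 4 by (simp add: E_def)
    then have U2: "U2 \<le> U y" using Uy[of v] v(3) by simp
    have ge: "u y \<le> U y" "w y \<le> W y"
      unfolding U_def W_def using u.ball_max_ge[OF yX] w.ball_max_ge[OF yX] e(1) by simp_all
    then have "0 \<le> q * (U y - u y)" using q by simp
    \<comment> \<open>All members of the cycle are now both nonnegative and nonpositive, so
      \<open>u\<close> and \<open>w\<close> agree with their ball maxima at \<open>y\<close>. As
      \<open>y\<close> competes in the ball about \<open>z\<close>, neither maximum can drop
      there.\<close>
    then have "q * (U y - u y) = 0" "W y = w y" using 5 6 3 4 U2 ge by linarith+
    then have eq: "U y = u y" "W y = w y" using q by auto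
    have "u y \<le> U z" "w y \<le> W z"
      unfolding U_def W_def
      using u.ball_max_upper[OF yX z(1)] w.ball_max_upper[OF yX z(1)] z(2) by (simp_all add: dist_commute)
    then show ?thesis using eq fy z y by (simp add: F_def E_def)
  qed
  have "connected X" using conn by (simp add: X_def connected_imp_connected_closure)
  moreover have "openin (top_of_set X) F"
    unfolding openin_euclidean_subtopology_iff
  proof (intro conjI ballI)
    show "F \<subseteq> X" by (auto simp: F_def E_def)
    show "\<exists>d>0. \<forall>z\<in>X. dist z y < d \<longrightarrow> z \<in> F" if "y \<in> F" for y
      using step[OF that] e(1) by (intro exI[of _ e]) (simp add: dist_commute)
  qed
  moreover have "closedin (top_of_set X) F"
    using clF by (rule closed_subset[rotated]) (auto simp: F_def E_def)
  ultimately have "F = {} \<or> F = X" unfolding connected_clopen by blast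
  moreover have "x1 \<in> F" using x1 by (simp add: F_def)
  ultimately have "F = X" by blast
  \<comment> \<open>A point of \<open>D\<close> in \<open>F\<close> attains the maximal level,
    contrary to the choice of \<open>e\<close>.\<close>
  obtain p where p: "p \<in> D" using D(2) by blast
  then have "p \<in> X" "p \<in> F" using D(3) \<open>F = X\<close> by (auto simp: X_def)
  then have "cball p (2 * e) \<inter> D = {}" using e(2)[of p] m by (simp add: F_def E_def U_def W_def)
  moreover have "p \<in> cball p (2 * e)" using e(1) by simp
  ultimately show False using p by blast
qed

end

section \<open>The three cases of the comparison principle\<close>

theorem theorem2p3:
  fixes \<Omega> A :: "'a::euclidean_space set" and \<nu> :: "'a \<Rightarrow> 'a" and \<beta> :: real
    and h h' u v :: "'a \<Rightarrow> real"
  assumes "bounded \<Omega>" "open \<Omega>" "connected \<Omega>"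
    and "C1_boundary_normal \<Omega> \<nu>"
    and "open A"
    and "frontier \<Omega> - A \<noteq> {}"
    and "frontier \<Omega> \<inter> A \<noteq> {} \<Longrightarrow> convex \<Omega>"
    and "bounded (h ` (\<Omega> \<union> (frontier \<Omega> \<inter> A)))"
    and "bounded (h' ` (\<Omega> \<union> (frontier \<Omega> \<inter> A)))"
    and "usc_on (\<Omega> \<union> (frontier \<Omega> \<inter> A)) h"
    and "lsc_on (\<Omega> \<union> (frontier \<Omega> \<inter> A)) h'"
    and "\<forall>x \<in> \<Omega> \<union> (frontier \<Omega> \<inter> A). h x \<le> h' x"
    and "(\<forall>x \<in> \<Omega> \<union> (frontier \<Omega> \<inter> A). h x < h' x) \<or>
         (\<forall>x \<in> \<Omega> \<union> (frontier \<Omega> \<inter> A). h x = 0) \<or>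
         (\<forall>x \<in> \<Omega> \<union> (frontier \<Omega> \<inter> A). h' x > 0)"
    and "viscosity_subsolution \<Omega> (frontier \<Omega> \<inter> A) \<nu> \<beta> h u"
    and "viscosity_supersolution \<Omega> (frontier \<Omega> \<inter> A) \<nu> \<beta> h' v"
  shows "\<exists>x0 \<in> frontier \<Omega> - A. \<forall>x \<in> closure \<Omega>. u x - v x \<le> u x0 - v x0"
proof -
  define \<Gamma> D w where "\<Gamma> = frontier \<Omega> \<inter> A" and "D = frontier \<Omega> - A" and "w x = - v x" for x
  interpret mixed_problem \<Omega> \<Gamma> \<nu> D \<beta> h h' u w
  proof
    show "viscosity_subsolution \<Omega> \<Gamma> \<nu> (- \<beta>) (\<lambda>x. - h' x) w"
      using viscosity_supersolution_uminus[OF assms(15)] by (simp add: \<Gamma>_def w_def[abs_def])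
    show "closed D" unfolding D_def using assms(5) by (intro closed_Diff frontier_closed)
    show "D \<inter> \<Omega> = {}" using assms(2) by (auto simp: D_def frontier_def interior_open)
  qed (use assms in \<open>auto simp: \<Gamma>_def D_def frontier_def\<close>)
  have D_sub: "D \<subseteq> closure \<Omega>" by (auto simp: D_def frontier_def)
  have "compact (closure \<Omega> \<inter> D)" using compact D(1) by (rule compact_Int_closed)
  then have "compact D" using D_sub by (simp add: Int_absorb1)
  then obtain x0 where x0: "x0 \<in> D" "\<And>d. d \<in> D \<Longrightarrow> u d + w d \<le> u x0 + w x0"
    using usc_on_attains_sup[OF _ D(2), of "\<lambda>x. u x + w x"]
      usc_on_subset[OF usc_on_add[OF u.usc w.usc] D_sub] by blast
  have h: "usc_on (\<Omega> \<union> \<Gamma>) h" and h': "lsc_on (\<Omega> \<union> \<Gamma>) h'"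
    using assms(10,11) by (simp_all add: \<Gamma>_def)
  have "u x + w x \<le> u x0 + w x0" if x: "x \<in> closure \<Omega>" for x
    using assms(13)
  proof (elim disjE)
    assume "\<forall>x \<in> \<Omega> \<union> (frontier \<Omega> \<inter> A). h x < h' x"
    then have "\<exists>d\<in>D. u x + 1 * w x \<le> u d + 1 * w d"
      by (intro comparison_strict[OF h h' _ _ x]) (auto simp: \<Gamma>_def)
    then show ?thesis using x0(2) by fastforce
  next
    assume "\<forall>x \<in> \<Omega> \<union> (frontier \<Omega> \<inter> A). h x = 0"
    then have "\<exists>d\<in>D. u x + w x \<le> u d + w d"
      using assms(12) by (intro comparison_zero[OF assms(3) _ _ x]) (auto simp: \<Gamma>_def)
    then show ?thesis using x0(2) by fastforce
  next
    assume pos: "\<forall>x \<in> \<Omega> \<union> (frontier \<Omega> \<inter> A). h' x > 0"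
    have "closure \<Omega> \<noteq> {}" using x by (metis empty_iff)
    from usc_on_attains_sup[OF compact this w.usc]
    obtain b where b: "b \<in> closure \<Omega>" "\<And>y. y \<in> closure \<Omega> \<Longrightarrow> w y \<le> w b"
      by metis
    show ?thesis
    proof (rule field_le_epsilon)
      fix e :: real assume e: "0 < e"
      \<comment> \<open>Here \<delta> depends on \<open>x\<close>, since w x need not be bounded
        below uniformly. The summand 1 keeps the denominator positive.\<close>
      define \<delta> where "\<delta> = e / (w b - w x + 1)"
      have den: "0 < w b - w x + 1" using b(2)[OF x] by simp
      then have \<delta>: "0 < \<delta>" "\<delta> * (w b - w x + 1) = e"
        using e by (simp_all add: \<delta>_def)
      \<comment> \<open>Positivity of h' makes the rescaled inequality strict. The perturbation then
        costs at most \<delta> (w b - w x), which is less than e.\<close>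
      have "h y < (1 + \<delta>) * h' y" if "y \<in> \<Omega> \<union> \<Gamma>" for y
      proof -
        have "0 < h' y" "h y \<le> h' y" using that pos assms(12) by (auto simp: \<Gamma>_def)
        moreover have "0 < \<delta> * h' y" using \<delta>(1) \<open>0 < h' y\<close> by simp
        ultimately show ?thesis by (simp add: distrib_right)
      qed
      then obtain d where d: "d \<in> D" "u x + (1 + \<delta>) * w x \<le> u d + (1 + \<delta>) * w d"
        using comparison_strict[OF h h' _ _ x, of "1 + \<delta>"] \<delta>(1) by force
      have "w d \<le> w b" using b(2) d(1) D_sub by blast
      then have "\<delta> * w d \<le> \<delta> * w b" using \<delta>(1) by simp
      moreover have "\<delta> * w b - \<delta> * w x + \<delta> = e" using \<delta>(2) by (simp add: distrib_left right_diff_distrib)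
      moreover have "u x + w x + \<delta> * w x \<le> u d + w d + \<delta> * w d" using d(2) by (simp add: distrib_right)
      ultimately show "u x + w x \<le> u x0 + w x0 + e"
        using x0(2)[OF d(1)] \<delta>(1) by linarith
    qed
  qed
  then show ?thesis using x0(1) by (intro bexI[of _ x0]) (auto simp: w_def D_def)
qed

end
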